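(* Fix an even modulus $n\ge2$ and a subset $S\subset\{0,\dots,n-1\}$ of size $n/2$. Let the stopping set be $$\mathfrak{S}=\{1\}\cup\{m\in\mathbb{Z}_{>0}: m=qn+r,\ r\in S,\ q\in\mathbb{Z}\}.$$ Start the discrete fragmentation process with stopping set $\mathfrak{S}$ from $R$ identical sticks of positive integer length $L\notin\mathfrak{S}$. Then, given that $R=R(L)>(\log L)^3$, for every base $B>1$ the collection of ending stick lengths converges to strong Benford behavior base $B$ as $L\to\infty$: if $P_{R,L}(s)$ is the proportion of ending sticks whose length has base-$B$ significand at most $s$, then for every $s\in[1,B)$, $$\lim_{L\to\infty}\mathbb{E}[P_{R(L),L}(s)]=\log_B s,\qquad \lim_{L\to\infty}\operatorname{Var}[P_{R(L),L}(s)]=0 ,$$ the limits being taken through $L\notin\mathfrak{S}$.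
   Context: $\log$ is the natural logarithm. Significand: for $B>1$, each $x>0$ is written uniquely as $x=S_B(x)B^{j}$ with $S_B(x)\in[1,B)$, $j\in\mathbb{Z}$; $S_B(x)$ is the significand. Convergence to strong Benford behavior of random finite collections (counted with multiplicity) is by definition the pair of limits displayed in the claim for all $s\in[1,B)$. Discrete fragmentation process with stopping set $\mathfrak{S}\subseteq\mathbb{Z}_{>0}$, started from $R$ sticks of integer length $L\notin\mathfrak{S}$: all starting sticks are alive. At each level, every living stick, of length $\ell$ say, is broken into two sticks of lengths $X$ and $\ell-X$, where $X$ is uniformly distributed on $\{1,\dots,\ell-1\}$, independently for different sticks. A new stick becomes dead (is never broken again) if its length is in $\mathfrak{S}$, and is alive otherwise. The process ends when all sticks are dead; the ending sticks are all the dead sticks. *)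

theory Defs
  imports "HOL-Probability.Probability"
begin

definition significand :: "real \<Rightarrow> real \<Rightarrow> real" where
  "significand B x = (THE S. S \<in> {1..<B} \<and> (\<exists>j::int. x = S * B powi j))"

lemma significand_ex1:
  fixes B x :: real
  assumes "B > 1" "x > 0"
  shows "\<exists>!S. S \<in> {1..<B} \<and> (\<exists>j::int. x = S * B powi j)"
proof (rule ex_ex1I)
  define j where "j = \<lfloor>log B x\<rfloor>"
  have "x = B powr (log B x)" using assms by simp
  have pw: "B powi j = B powr j" using assms by (simp add: powr_real_of_int')
  have "B powr j \<le> x" using assms by (subst le_log_iff[symmetric]) (auto simp: j_def)
  moreover have "x < B powr (j + 1)"
    using assms by (subst log_less_iff[symmetric]) (auto simp: j_def)
  ultimately have "x / B powi j \<in> {1..<B} \<and> x = x / B powi j * B powi j"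
    using assms by (auto simp: pw field_simps powr_add)
  then show "\<exists>S. S \<in> {1..<B} \<and> (\<exists>j::int. x = S * B powi j)" by blast
next
  fix S T
  assume "S \<in> {1..<B} \<and> (\<exists>j::int. x = S * B powi j)"
    and "T \<in> {1..<B} \<and> (\<exists>j::int. x = T * B powi j)"
  then obtain i j :: int where S: "1 \<le> S" "S < B" "x = S * B powi i"
    and T: "1 \<le> T" "T < B" "x = T * B powi j" unfolding atLeastLessThan_iff by blast
  have floor: "\<lfloor>log B x\<rfloor> = k" if "1 \<le> U" "U < B" "x = U * B powi k" for U and k :: int
  proof -
    have "log B x = log B U + k"
      using that assms by (simp add: log_mult powr_real_of_int'[symmetric])
    moreover have "0 \<le> log B U" "log B U < 1" using that assms by auto
    ultimately show ?thesis by linarith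
  qed
  have "i = j" using floor[OF S] floor[OF T] by simp
  then show "S = T" using S T assms by simp
qed

definition stopping_set :: "nat \<Rightarrow> nat set \<Rightarrow> nat set" where
  "stopping_set n S = {1} \<union> {m. m > 0 \<and> (\<exists>q::int. \<exists>r\<in>S. int m = q * int n + int r)}"

text \<open>
  A collection of sticks, counted with multiplicity, is the list of their lengths; the order
  carries no meaning. A stick is dead iff its length is in the stopping set \<open>D\<close>. For
  \<open>l \<le> 1\<close> outside \<open>D\<close> the set \<open>{1..l - 1}\<close> is empty and \<^const>\<open>pmf_of_set\<close> is
  unspecified; this does not occur when \<open>1 \<in> D\<close> and all lengths are positive.
\<close>

definition break_stick :: "nat set \<Rightarrow> nat \<Rightarrow> nat list pmf" where
  "break_stick D l =
     (if l \<in> D then return_pmf [l] else map_pmf (\<lambda>x. [x, l - x]) (pmf_of_set {1..l - 1}))"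

text \<open>One level; \<^const>\<open>pair_pmf\<close> makes the breaks of different sticks independent.\<close>

primrec break_all :: "nat set \<Rightarrow> nat list \<Rightarrow> nat list pmf" where
  "break_all D [] = return_pmf []"
| "break_all D (l # ls) = map_pmf (\<lambda>(xs, ys). xs @ ys) (pair_pmf (break_stick D l) (break_all D ls))"

primrec fragmentation :: "nat set \<Rightarrow> nat \<Rightarrow> nat list \<Rightarrow> nat list pmf" where
  "fragmentation D 0 ls = return_pmf ls"
| "fragmentation D (Suc k) ls = bind_pmf (fragmentation D k ls) (break_all D)"

text \<open>
  A living stick only produces strictly shorter ones, so sticks of length \<open>L\<close> are all dead after
  \<open>L\<close> levels, and the collection no longer changes from then on
  (\<open>ending_sticks_dead\<close> and \<open>fragmentation_eq_ending_sticks\<close> below).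
\<close>

definition ending_sticks :: "nat set \<Rightarrow> nat \<Rightarrow> nat \<Rightarrow> nat list pmf" where
  "ending_sticks D R L = fragmentation D L (replicate R L)"

definition significand_proportion :: "real \<Rightarrow> real \<Rightarrow> nat list \<Rightarrow> real" where
  "significand_proportion B s ls =
     real (length (filter (\<lambda>m. significand B (real m) \<le> s) ls)) / real (length ls)"

lemma set_break_stick:
  assumes "1 \<in> D" "0 < l" "xs \<in> set_pmf (break_stick D l)" "m \<in> set xs"
  shows "0 < m \<and> (l \<in> D \<and> m = l \<or> l \<notin> D \<and> m < l)"
proof (cases "l \<in> D")
  case False
  with assms have "l \<noteq> 1" by auto
  with assms have "{1..l - 1} \<noteq> {}" by auto
  with False assms show ?thesis by (auto simp: break_stick_def)
qed (use assms in \<open>auto simp: break_stick_def\<close>)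

lemma set_break_all:
  assumes "1 \<in> D" "\<forall>l\<in>set ls. 0 < l" "xs \<in> set_pmf (break_all D ls)" "m \<in> set xs"
  shows "0 < m \<and> (\<exists>l\<in>set ls. l \<in> D \<and> m = l \<or> l \<notin> D \<and> m < l)"
  using assms
proof (induction ls arbitrary: xs)
  case (Cons l ls)
  then obtain ys zs where "xs = ys @ zs" "ys \<in> set_pmf (break_stick D l)"
    "zs \<in> set_pmf (break_all D ls)" by auto
  then show ?case
    using Cons.IH[of zs] Cons.prems set_break_stick[of D l ys m] by auto
qed simp

lemma break_all_dead: "set ls \<subseteq> D \<Longrightarrow> break_all D ls = return_pmf ls"
  by (induction ls) (auto simp: break_stick_def pair_return_pmf1)

lemma set_fragmentation:
  assumes "1 \<in> D" "0 < L" "xs \<in> set_pmf (fragmentation D k (replicate R L))" "m \<in> set xs"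
  shows "0 < m \<and> (m \<in> D \<or> m + k \<le> L)"
  using assms(3,4)
proof (induction k arbitrary: xs m)
  case 0
  with assms show ?case by auto
next
  case (Suc k)
  then obtain ys where ys: "ys \<in> set_pmf (fragmentation D k (replicate R L))"
    "xs \<in> set_pmf (break_all D ys)" by auto
  have "0 < m \<and> (\<exists>l\<in>set ys. l \<in> D \<and> m = l \<or> l \<notin> D \<and> m < l)"
    using set_break_all[OF assms(1) _ ys(2) Suc.prems(2)] Suc.IH[OF ys(1)] by blast
  with Suc.IH[OF ys(1)] show ?case by fastforce
qed

lemma ending_sticks_dead:
  assumes "1 \<in> D" "0 < L" "xs \<in> set_pmf (ending_sticks D R L)"
  shows "set xs \<subseteq> D"
  using set_fragmentation[OF assms(1,2) assms(3)[unfolded ending_sticks_def]] by fastforce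

lemma fragmentation_eq_ending_sticks:
  assumes "1 \<in> D" "0 < L" "L \<le> k"
  shows "fragmentation D k (replicate R L) = ending_sticks D R L"
  using assms(3)
proof (induction rule: dec_induct)
  case (step k)
  have "bind_pmf (ending_sticks D R L) (break_all D) = bind_pmf (ending_sticks D R L) return_pmf"
    using ending_sticks_dead[OF assms(1,2)] break_all_dead by (intro bind_pmf_cong) auto
  with step show ?case by (simp add: bind_return_pmf')
qed (simp add: ending_sticks_def)

end

theory Submission
  imports Defs "HOL-Real_Asymp.Real_Asymp"
begin

text \<open>
  Everything reduces to one starting stick, because the collections coming from different
  starting sticks are independent. Let \<open>f\<close> be the indicator of the lengths with significand
  at most \<open>s\<close>, and let \<open>F(l)\<close> be the expected number of such ending sticks produced by
  one stick of length \<open>l\<close>. Conditioning on the first break gives \<open>F(l) = f(l)\<close> on \<open>D\<close>, and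
  off \<open>D\<close>
  \<open>F(l) = 2/(l-1) * (F(1) + \<dots> + F(l-1))\<close>.
  This is a first-order recursion for the partial sums of \<open>F\<close>, with the integrating factor
  \<open>G(m) = \<Prod> (k+1)/(k-1)\<close> over the living \<open>k \<le> m\<close>; for living \<open>l\<close> it yields
  \<open>F(l) = 2/(l-1) * G(l-1) * (sum of f(k)/G(k) over dead k < l)\<close>
  (\<open>frag_recursion_solution\<close>).

  Half of the residues are dead, so the signs \<open>\<plusminus>1\<close> that mark dead and living lengths have
  bounded partial sums, and their series weighted by \<open>1/k\<close> converges (\<open>log_balanced\<close>). Two
  consequences carry the proof: \<open>G(m)/m\<close> tends to a positive constant \<open>c\<close>
  (\<open>growth_asymp\<close>), and the sum of \<open>1/k\<close> over dead \<open>k\<close> in a window \<open>[x, y x]\<close> tends to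
  \<open>(ln y)/2\<close> as \<open>x\<close> grows (\<open>dead_harm_window\<close>). Cutting \<open>[1, m]\<close> at the powers of \<open>B\<close> and
  averaging over the windows shows that the dead lengths with significand at most \<open>s\<close> have
  logarithmic density \<open>(log B s)/2\<close> (\<open>log_density_significand\<close>). The constant \<open>c\<close> cancels,
  so \<open>F(L) ~ (log B s) ln L\<close>, while the expected total number \<open>N(L)\<close> of ending sticks is
  asymptotic to \<open>ln L\<close> (\<open>frag_mean_asymp\<close>).

  The second moment of the number of ending sticks of one stick obeys the same recursion with
  a source term of size \<open>O((ln l)^2)\<close>, hence is \<open>O((ln L)^3)\<close> (\<open>second_moment_cubic_bound\<close>).
  With \<open>R\<close> independent sticks, numerator and denominator of the proportion have variance at
  most \<open>R\<close> times this, which is negligible against the squared mean \<open>(R ln L)^2\<close>. A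
  deterministic inequality (\<open>ratio_deviation_bound\<close>) transfers this to the quotient and shows
  that its mean square distance from \<open>log B s\<close> tends to \<open>0\<close>. That quantity dominates both the
  variance and the squared bias of the proportion.
\<close>

section \<open>Summation lemmas\<close>

text \<open>
  The regularity half of the Silverman--Toeplitz theorem: finitely many terms are swallowed by
  \<open>r \<rightarrow> \<infinity>\<close>, and the others are small relative to the mass of \<open>p\<close>. The index sets \<open>A x\<close> are
  arbitrary, so the same lemma serves the weights \<open>1/k\<close> on a subset of \<open>{1..m}\<close> and plain
  averages.
\<close>

lemma weighted_mean_tendsto_0:
  fixes g p :: "nat \<Rightarrow> real" and r :: "'a \<Rightarrow> real" and A :: "'a \<Rightarrow> nat set"
  assumes g: "g \<longlonglongrightarrow> 0" and p: "\<And>k. p k \<ge> 0" and r: "filterlim r at_top F"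
    and fin: "\<And>x. finite (A x)" and mass: "eventually (\<lambda>x. (\<Sum>k\<in>A x. p k) \<le> C * r x) F"
  shows "((\<lambda>x. (\<Sum>k\<in>A x. p k * g k) / r x) \<longlongrightarrow> 0) F"
proof (rule tendstoI)
  fix e :: real assume e: "e > 0"
  define C' where "C' = max C 1"
  have C': "C' > 0" "C \<le> C'" by (auto simp: C'_def)
  define d where "d = e / (2 * C')"
  have d: "d > 0" using e C' by (simp add: d_def)
  obtain K where K: "\<And>k. k \<ge> K \<Longrightarrow> \<bar>g k\<bar> < d"
    using tendstoD[OF g d] by (auto simp: eventually_sequentially dist_real_def)
  define M where "M = (\<Sum>k<K. p k * \<bar>g k\<bar>)"
  have M: "M \<ge> 0" unfolding M_def by (intro sum_nonneg mult_nonneg_nonneg p) auto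
  have "eventually (\<lambda>x. r x > 2 * M / e) F" "eventually (\<lambda>x. r x > 0) F"
    using r by (auto simp: filterlim_at_top_dense)
  then show "eventually (\<lambda>x. dist ((\<Sum>k\<in>A x. p k * g k) / r x) 0 < e) F"
    using mass
  proof eventually_elim
    case (elim x)
    have "\<bar>\<Sum>k\<in>A x. p k * g k\<bar> \<le> (\<Sum>k\<in>A x. p k * \<bar>g k\<bar>)"
      by (rule order_trans[OF sum_abs]) (simp add: abs_mult p)
    also have "\<dots> = (\<Sum>k\<in>A x \<inter> {..<K}. p k * \<bar>g k\<bar>) + (\<Sum>k\<in>A x - {..<K}. p k * \<bar>g k\<bar>)"
      using fin by (subst sum.Int_Diff[of _ _ "{..<K}"]) auto
    also have "(\<Sum>k\<in>A x \<inter> {..<K}. p k * \<bar>g k\<bar>) \<le> M"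
      unfolding M_def by (rule sum_mono2) (auto simp: p)
    also have "(\<Sum>k\<in>A x - {..<K}. p k * \<bar>g k\<bar>) \<le> (\<Sum>k\<in>A x - {..<K}. p k * d)"
      by (intro sum_mono mult_left_mono p) (use K in \<open>auto intro: less_imp_le\<close>)
    also have "\<dots> \<le> (\<Sum>k\<in>A x. p k * d)"
      by (rule sum_mono2) (use fin p d in auto)
    also have "\<dots> \<le> C * r x * d"
      unfolding sum_distrib_right[symmetric] using elim(3) d by (intro mult_right_mono) auto
    also have "\<dots> \<le> C' * r x * d" using C' elim d by (intro mult_right_mono) auto
    also have "\<dots> = e / 2 * r x" using C' by (simp add: d_def)
    finally have "\<bar>\<Sum>k\<in>A x. p k * g k\<bar> \<le> M + e / 2 * r x" by simp
    moreover have "M < e / 2 * r x" using elim(1) e by (simp add: field_simps)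
    ultimately have "\<bar>\<Sum>k\<in>A x. p k * g k\<bar> < e * r x" by simp
    then show ?case using elim(2) by (simp add: dist_real_def divide_simps)
  qed
qed

lemma cesaro_mean:
  fixes u :: "nat \<Rightarrow> real"
  assumes "u \<longlonglongrightarrow> l"
  shows "(\<lambda>n. (\<Sum>j<n. u j) / n) \<longlonglongrightarrow> l"
proof -
  have "(\<lambda>n. (\<Sum>j\<in>{..<n}. 1 * (u j - l)) / real n) \<longlonglongrightarrow> 0"
    by (rule weighted_mean_tendsto_0[where C = 1])
       (use assms in \<open>auto intro: LIM_zero filterlim_real_sequentially\<close>)
  moreover have "eventually (\<lambda>n. (\<Sum>j\<in>{..<n}. 1 * (u j - l)) / real n = (\<Sum>j<n. u j) / n - l) sequentially"
    using eventually_gt_at_top[of 0]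
    by eventually_elim (simp add: sum_subtractf field_simps)
  ultimately have "(\<lambda>n. (\<Sum>j<n. u j) / n - l) \<longlonglongrightarrow> 0"
    by (rule Lim_transform_eventually)
  then show ?thesis by (rule LIM_zero_cancel)
qed

text \<open>
  Dirichlet's test for the weights \<open>1/k\<close>: summation by parts replaces them by the absolutely
  summable differences \<open>1/k - 1/(k+1)\<close>.
\<close>

lemma convergent_sum_over_index:
  fixes a :: "nat \<Rightarrow> real"
  assumes bd: "\<And>m. \<bar>\<Sum>k=1..m. a k\<bar> \<le> C"
  shows "convergent (\<lambda>m. \<Sum>k=1..m. a k / k)"
proof -
  define A where "A m = (\<Sum>k=1..m. a k)" for m
  define d where "d k = 1 / real k - 1 / real (Suc k)" for k
  have parts: "(\<Sum>k=1..m. a k / k) = A m / Suc m + (\<Sum>k=1..m. A k * d k)" for m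
  proof (induction m)
    case (Suc m)
    have "A (Suc m) = A m + a (Suc m)" by (simp add: A_def)
    then have "A m / Suc m + a (Suc m) / Suc m = A (Suc m) / Suc (Suc m) + A (Suc m) * d (Suc m)"
      by (simp only: d_def right_diff_distrib times_divide_eq_right mult_1_right add_divide_distrib)
    with Suc show ?case by simp
  qed (simp add: A_def)
  have sd: "summable d"
    unfolding d_def using telescope_summable'[of "\<lambda>k. 1 / real k" 0] by (simp add: lim_1_over_n)
  have "summable (\<lambda>k. A k * d k)"
  proof (rule summable_comparison_test')
    show "summable (\<lambda>k. C * d k)" using sd by (rule summable_mult)
    fix k :: nat assume "1 \<le> k"
    then have "d k \<ge> 0" by (simp add: d_def field_simps)
    then show "norm (A k * d k) \<le> C * d k"
      using bd[of k] by (simp add: abs_mult A_def mult_right_mono)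
  qed
  then have "summable (\<lambda>k. A (Suc k) * d (Suc k))" by (subst summable_Suc_iff)
  then have c2: "convergent (\<lambda>m. \<Sum>k=1..m. A k * d k)"
    unfolding summable_iff_convergent
    by (simp add: sum.atLeast1_atMost_eq)
  have "(\<lambda>m. A m / Suc m) \<longlonglongrightarrow> 0"
  proof (rule Lim_null_comparison)
    show "eventually (\<lambda>m. norm (A m / Suc m) \<le> C / Suc m) sequentially"
      using bd by (auto intro!: always_eventually divide_right_mono simp: A_def)
    show "(\<lambda>m. C / real (Suc m)) \<longlonglongrightarrow> 0" by real_asymp
  qed
  then have "convergent (\<lambda>m. A m / Suc m)" by (rule convergentI)
  from convergent_add[OF this c2] show ?thesis unfolding parts .
qed

section \<open>Stopping sets with logarithmically balanced signs\<close>

text \<open>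
  Convergence of the signed harmonic series, rather than mere equality of the logarithmic
  densities of \<open>D\<close> and its complement, is what makes \<open>growth\<close> below asymptotically linear. It
  also means that \<open>D\<close> gets half the harmonic mass up to an error \<open>o(1)\<close> on every window
  \<open>[x, y x]\<close>. Membership of \<open>1\<close> ensures that every living stick can be broken.
\<close>

definition log_balanced :: "nat set \<Rightarrow> bool" where
  "log_balanced D \<longleftrightarrow>
     1 \<in> D \<and> convergent (\<lambda>m. \<Sum>k=1..m. (if k \<in> D then 1 else - 1) / real k)"

text \<open>
  Full periods cancel, so the partial sums of a periodic sequence of mean zero are bounded.
\<close>

lemma sum_periodic_mean_zero:
  fixes b :: "nat \<Rightarrow> real"
  assumes "n > 0" "(\<Sum>r<n. b r) = 0"
  shows "(\<Sum>k<m. b (k mod n)) = (\<Sum>r<m mod n. b r)"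
proof (induction m)
  case (Suc m)
  show ?case
  proof (cases "Suc (m mod n) = n")
    case True
    then have "(\<Sum>k<Suc m. b (k mod n)) = (\<Sum>r<n. b r)"
      using Suc.IH by (metis sum.lessThan_Suc)
    with True assms show ?thesis by (simp add: mod_Suc)
  qed (use Suc in \<open>simp add: mod_Suc\<close>)
qed simp

text \<open>
  The signs are periodic with mean zero because half of the residues are dead; adjoining the
  length \<open>1\<close> changes a single term.
\<close>

lemma log_balanced_stopping_set:
  assumes n: "n \<ge> 2" "even n" and S: "S \<subseteq> {0..<n}" "card S = n div 2"
  shows "log_balanced (stopping_set n S)"
proof -
  let ?D = "stopping_set n S"
  define a where "a k = (if k \<in> ?D then 1 else - 1 :: real)" for k
  define b where "b r = (if r \<in> S then 1 else - 1 :: real)" for r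
  have mem: "k \<in> ?D \<longleftrightarrow> k mod n \<in> S" if "k \<ge> 2" for k
  proof
    assume "k \<in> ?D"
    then have "\<exists>q::int. \<exists>r\<in>S. int k = q * int n + int r"
      using that by (simp add: stopping_set_def)
    then obtain q :: int and r where qr: "r \<in> S" "int k = q * int n + int r" by blast
    have "int (k mod n) = int r mod int n" using qr(2) by (simp add: zmod_int)
    also have "\<dots> = int r" using S(1) qr(1) by auto
    finally show "k mod n \<in> S" using qr(1) by simp
  next
    assume "k mod n \<in> S"
    moreover have "int k = int (k div n) * int n + int (k mod n)"
      by (metis div_mult_mod_eq of_nat_add of_nat_mult)
    ultimately have "\<exists>q::int. \<exists>r\<in>S. int k = q * int n + int r" by blast
    then show "k \<in> ?D" using that by (simp add: stopping_set_def)
  qed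
  have "(\<Sum>r<n. b r) = (\<Sum>r\<in>{..<n} \<inter> S. b r) + (\<Sum>r\<in>{..<n} - S. b r)"
    by (rule sum.Int_Diff) simp
  also have "\<dots> = (\<Sum>r\<in>S. 1) + (\<Sum>r\<in>{..<n} - S. - 1)"
    using S(1) by (intro arg_cong2[where f = "(+)"] sum.cong) (auto simp: b_def)
  also have "\<dots> = real (card S) - real (card ({..<n} - S))" by simp
  also have "card ({..<n} - S) = n - card S"
    using S(1) finite_subset[OF S(1)] by (subst card_Diff_subset) (auto simp: lessThan_atLeast0)
  also have "real (card S) - real (n - card S) = 0" using S(2) n(2) by auto
  finally have b0: "(\<Sum>r<n. b r) = 0" .
  have bb: "\<bar>\<Sum>k<m. b (k mod n)\<bar> \<le> n" for m
  proof -
    have "\<bar>\<Sum>r<m mod n. b r\<bar> \<le> (\<Sum>r<m mod n. \<bar>b r\<bar>)" by (rule sum_abs)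
    also have "\<dots> = (\<Sum>r<m mod n. 1)" by (intro sum.cong) (auto simp: b_def)
    also have "\<dots> = m mod n" by simp
    also have "\<dots> \<le> n" using n by (simp add: less_imp_le)
    finally show ?thesis using sum_periodic_mean_zero[OF _ b0, of m] n by simp
  qed
  \<comment> \<open>The constant corrects for the index 0, absent on the left, and for the length 1, which is dead
    whatever its residue.\<close>
  have ab: "(\<Sum>k=1..Suc m. a k) = (\<Sum>k<Suc (Suc m). b (k mod n)) + (a 1 - b 1 - b 0)" for m
  proof (induction m)
    case 0 then show ?case using n by simp
  next
    case (Suc m)
    have "a (Suc (Suc m)) = b (Suc (Suc m) mod n)" using mem by (simp add: a_def b_def)
    with Suc show ?case by simp
  qed
  have "\<bar>\<Sum>k=1..m. a k\<bar> \<le> n + 3" for m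
  proof (cases m)
    case (Suc m')
    have "\<bar>a 1 - b 1 - b 0\<bar> \<le> 3" by (simp add: a_def b_def)
    then show ?thesis unfolding Suc ab using bb[of "Suc (Suc m')"] by linarith
  qed simp
  from convergent_sum_over_index[OF this] show ?thesis
    by (simp add: log_balanced_def a_def stopping_set_def)
qed

text \<open>
  The integrating factor of the recursion for partial sums: if \<open>k\<close> is alive, adding the value
  \<open>2/(k-1) * T\<close> to a partial sum \<open>T\<close> multiplies it by \<open>1 + 2/(k-1) = (k+1)/(k-1)\<close>.
\<close>

definition growth :: "nat set \<Rightarrow> nat \<Rightarrow> real" where
  "growth D m = (\<Prod>k\<in>{1..m} - D. (real k + 1) / (real k - 1))"

definition dead_harm :: "nat set \<Rightarrow> nat \<Rightarrow> real" where
  "dead_harm D m = (\<Sum>k\<in>{1..m} \<inter> D. 1 / k)"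

lemma growth_0 [simp]: "growth D 0 = 1" by (simp add: growth_def)

lemma growth_Suc:
  "growth D (Suc m) = growth D m * (if Suc m \<in> D then 1 else (real m + 2) / real m)"
proof (cases "Suc m \<in> D")
  case True
  then have "{1..Suc m} - D = {1..m} - D" by (auto simp: le_Suc_eq)
  with True show ?thesis by (simp add: growth_def)
next
  case False
  then have "{1..Suc m} - D = insert (Suc m) ({1..m} - D)" by (auto simp: le_Suc_eq)
  with False show ?thesis by (simp add: growth_def add.commute)
qed

lemma growth_pos: "1 \<in> D \<Longrightarrow> growth D m > 0"
  unfolding growth_def
proof (rule prod_pos)
  fix k assume "1 \<in> D" "k \<in> {1..m} - D"
  then have "k \<noteq> 1" "k \<ge> 1" by auto
  then have "k \<ge> 2" by simp
  then show "(real k + 1) / (real k - 1) > 0" by simp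
qed

text \<open>
  A living factor contributes \<open>ln ((k+1)/(k-1)) = 2/k + O(1/k^2)\<close> to the logarithm. Since \<open>2/k\<close>
  on living \<open>k\<close> (and \<open>0\<close> on dead ones) is \<open>1/k\<close> minus the signed term, the logarithm is a
  harmonic sum plus convergent series, that is \<open>ln m\<close> plus a convergent sequence.
\<close>

lemma growth_asymp:
  assumes "log_balanced D"
  obtains c where "c > 0" "(\<lambda>m. growth D m / m) \<longlonglongrightarrow> c"
proof -
  define a where "a k = (if k \<in> D then 1 else - 1 :: real)" for k
  define f where "f k = ln ((real k + 1) / (real k - 1)) - 2 / real k" for k
  define e where "e k = (if k \<in> D then 0 else f k)" for k
  have 1: "1 \<in> D" and ca: "convergent (\<lambda>m. \<Sum>k=1..m. a k / k)"
    using assms by (auto simp: log_balanced_def a_def)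
  have "f \<in> O(\<lambda>k. 1 / real k ^ 2)" unfolding f_def by real_asymp
  moreover have "e \<in> O(f)" by (rule bigoI[where c = 1]) (simp add: e_def)
  ultimately have "e \<in> O(\<lambda>k. 1 / real k ^ 2)" using landau_o.big_trans by blast
  then have "summable e"
    by (rule summable_comparison_test_bigo[rotated])
       (use inverse_power_summable[of 2, where 'a = real] in \<open>simp add: field_simps\<close>)
  then have "summable (\<lambda>k. e (Suc k))" by (subst summable_Suc_iff)
  then have ce: "convergent (\<lambda>m. \<Sum>k=1..m. e k)"
    unfolding summable_iff_convergent by (simp add: sum.atLeast1_atMost_eq)
  have lg: "ln (growth D m) = (\<Sum>k=1..m. e k) + harm m - (\<Sum>k=1..m. a k / k)" for m
  proof (induction m)
    case (Suc m)
    show ?case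
    proof (cases "Suc m \<in> D")
      case True
      with Suc show ?thesis by (simp add: growth_Suc e_def a_def harm_Suc divide_inverse)
    next
      case False
      with 1 have "m \<noteq> 0" by (metis One_nat_def)
      then have "ln (growth D (Suc m)) = ln (growth D m) + ln ((real m + 2) / m)"
        using False growth_pos[OF 1, of m] 
        by (simp only: growth_Suc if_False) (rule ln_mult_pos, simp_all)
      moreover have "ln ((real m + 2) / m) = e (Suc m) + 2 / Suc m"
        using False by (simp add: e_def f_def add.commute del: ln_div)
      ultimately show ?thesis
        using Suc False by (simp add: a_def harm_Suc divide_inverse)
    qed
  qed (simp add: harm_def)
  have "convergent (\<lambda>m. (\<Sum>k=1..m. e k) + (harm m - ln m) - (\<Sum>k=1..m. a k / k))"
    by (intro convergent_add convergent_diff ce ca euler_mascheroni_convergent)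
  then obtain l where "(\<lambda>m. (\<Sum>k=1..m. e k) + (harm m - ln m) - (\<Sum>k=1..m. a k / k)) \<longlonglongrightarrow> l"
    by (auto simp: convergent_def)
  then have "(\<lambda>m. exp ((\<Sum>k=1..m. e k) + (harm m - ln m) - (\<Sum>k=1..m. a k / k))) \<longlonglongrightarrow> exp l"
    by (rule tendsto_exp)
  moreover have "eventually (\<lambda>m. exp ((\<Sum>k=1..m. e k) + (harm m - ln m) - (\<Sum>k=1..m. a k / k))
      = growth D m / m) sequentially"
    using eventually_gt_at_top[of 0]
  proof eventually_elim
    case (elim m)
    have "(\<Sum>k=1..m. e k) + (harm m - ln m) - (\<Sum>k=1..m. a k / k) = ln (growth D m) - ln m"
      using lg[of m] by simp
    also have "exp \<dots> = growth D m / m" using elim growth_pos[OF 1] by (simp add: exp_diff)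
    finally show ?case .
  qed
  ultimately have "(\<lambda>m. growth D m / m) \<longlonglongrightarrow> exp l" by (rule Lim_transform_eventually)
  then show ?thesis by (intro that[of "exp l"]) auto
qed

text \<open>
  Likewise \<open>1/k\<close> on dead \<open>k\<close> is half the sum of \<open>1/k\<close> and the signed term.
\<close>

lemma dead_harm_asymp:
  assumes "log_balanced D"
  obtains \<kappa> where "(\<lambda>m. dead_harm D m - ln m / 2) \<longlonglongrightarrow> \<kappa>"
proof -
  define a where "a k = (if k \<in> D then 1 else - 1 :: real)" for k
  have ca: "convergent (\<lambda>m. \<Sum>k=1..m. a k / k)"
    using assms by (auto simp: log_balanced_def a_def)
  have eq: "dead_harm D m - ln m / 2 = ((harm m - ln m) + (\<Sum>k=1..m. a k / k)) / 2" for m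
  proof -
    have "dead_harm D m = (\<Sum>k=1..m. if k \<in> D then 1 / k else 0)"
      unfolding dead_harm_def by (subst sum.inter_restrict) auto
    also have "\<dots> = (\<Sum>k=1..m. (1 / k + a k / k) / 2)"
      by (intro sum.cong) (auto simp: a_def)
    also have "\<dots> = (harm m + (\<Sum>k=1..m. a k / k)) / 2"
      by (simp add: harm_def sum.distrib sum_divide_distrib[symmetric] inverse_eq_divide)
    finally show ?thesis by (simp add: field_simps)
  qed
  have "convergent (\<lambda>m. dead_harm D m - ln m / 2)"
    unfolding eq
    using convergent_mult[OF convergent_add[OF euler_mascheroni_convergent ca] convergent_const[of "1 / 2"]]
    by simp
  then show ?thesis using that by (auto simp: convergent_def)
qed

section \<open>Logarithmic density of a significand condition\<close>

lemma ln_round_asymp: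
  fixes \<phi> :: "'a \<Rightarrow> nat" and z :: "'a \<Rightarrow> real"
  assumes z: "filterlim z at_top F" and close: "\<And>x. \<bar>real (\<phi> x) - z x\<bar> \<le> 1"
  shows "((\<lambda>x. ln (\<phi> x) - ln (z x)) \<longlongrightarrow> 0) F" and "filterlim \<phi> at_top F"
proof -
  have "((\<lambda>x. inverse (z x)) \<longlongrightarrow> 0) F"
    by (rule filterlim_compose[OF tendsto_inverse_0_at_top z]) (rule filterlim_ident)
  moreover have zpos: "eventually (\<lambda>x. z x > 1) F" using z by (auto simp: filterlim_at_top_dense)
  then have "eventually (\<lambda>x. norm (real (\<phi> x) / z x - 1) \<le> inverse (z x)) F"
  proof eventually_elim
    case (elim x)
    then have "norm (real (\<phi> x) / z x - 1) = \<bar>real (\<phi> x) - z x\<bar> / z x"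
      by (simp add: divide_simps abs_if)
    also have "\<dots> \<le> 1 / z x" using close[of x] elim by (intro divide_right_mono) auto
    finally show ?case by (simp add: inverse_eq_divide)
  qed
  ultimately have "((\<lambda>x. real (\<phi> x) / z x - 1) \<longlongrightarrow> 0) F" by (rule Lim_null_comparison[rotated])
  then have "((\<lambda>x. real (\<phi> x) / z x) \<longlongrightarrow> 1) F" by (rule LIM_zero_cancel)
  then have "((\<lambda>x. ln (real (\<phi> x) / z x)) \<longlongrightarrow> ln 1) F" by (rule tendsto_ln) simp
  moreover have "eventually (\<lambda>x. ln (real (\<phi> x) / z x) = ln (\<phi> x) - ln (z x)) F"
    using zpos
  proof eventually_elim
    case (elim x)
    then have "real (\<phi> x) > 0" using close[of x] by linarith
    with elim show ?case by (intro ln_divide_pos) auto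
  qed
  ultimately show "((\<lambda>x. ln (\<phi> x) - ln (z x)) \<longlongrightarrow> 0) F"
    by (simp add: Lim_transform_eventually)
  show "filterlim \<phi> at_top F"
    unfolding filterlim_at_top
  proof
    fix N :: nat
    have "eventually (\<lambda>x. z x > real N + 1) F" using z by (auto simp: filterlim_at_top_dense)
    then show "eventually (\<lambda>x. N \<le> \<phi> x) F"
    proof eventually_elim
      case (elim x)
      then show ?case using close[of x] by linarith
    qed
  qed
qed

lemma dead_harm_round:
  assumes "(\<lambda>m. dead_harm D m - ln m / 2) \<longlonglongrightarrow> \<kappa>"
    and z: "filterlim z at_top F" and close: "\<And>x. \<bar>real (\<phi> x) - z x\<bar> \<le> 1"
  shows "((\<lambda>x. dead_harm D (\<phi> x) - ln (z x) / 2) \<longlongrightarrow> \<kappa>) F"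
proof -
  note \<phi> = ln_round_asymp[of z F \<phi>, OF z close]
  have "((\<lambda>x. (dead_harm D (\<phi> x) - ln (\<phi> x) / 2) + (ln (\<phi> x) - ln (z x)) / 2) \<longlongrightarrow> \<kappa> + 0 / 2) F"
    by (intro tendsto_add tendsto_divide tendsto_const \<phi>(1) filterlim_compose[OF assms(1) \<phi>(2)]) simp
  then show ?thesis by (simp add: diff_divide_distrib)
qed

lemma dead_harm_diff:
  assumes "l \<le> m"
  shows "(\<Sum>k\<in>{l<..m} \<inter> D. 1 / k) = dead_harm D m - dead_harm D l"
proof -
  have "{1..m} \<inter> D = ({1..l} \<inter> D) \<union> ({l<..m} \<inter> D)" using assms by auto
  then have "dead_harm D m = dead_harm D l + (\<Sum>k\<in>{l<..m} \<inter> D. 1 / k)"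
    unfolding dead_harm_def by (simp only:) (subst sum.union_disjoint, auto)
  then show ?thesis by simp
qed

text \<open>
  The window \<open>[z, y z]\<close> is closed at both ends because a significand at most \<open>s\<close> means
  \<open>B^j \<le> k \<le> s B^j\<close>. The harmonic mass of \<open>D\<close> up to \<open>x\<close> is \<open>(ln x)/2 + \<kappa> + o(1)\<close>, and the
  constant cancels between the two ends.
\<close>

lemma dead_harm_window:
  assumes D: "log_balanced D" and z: "filterlim z at_top F" and z1: "\<And>x. z x \<ge> 1" and y: "y \<ge> 1"
  shows "((\<lambda>x. \<Sum>k\<in>{k. z x \<le> real k \<and> real k \<le> y * z x} \<inter> D. 1 / k) \<longlongrightarrow> ln y / 2) F"
proof -
  obtain \<kappa> where \<kappa>: "(\<lambda>m. dead_harm D m - ln m / 2) \<longlonglongrightarrow> \<kappa>"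
    using dead_harm_asymp[OF D] by blast
  \<comment> \<open>The integers in the closed window are those in the half-open interval from \<open>lo x\<close> to \<open>hi x\<close>;
    the shift by one in \<open>lo\<close> keeps the left endpoint.\<close>
  define lo where "lo x = nat \<lceil>z x\<rceil> - 1" for x
  define hi where "hi x = nat \<lfloor>y * z x\<rfloor>" for x
  have yz: "y * z x \<ge> z x" for x using mult_right_mono[of 1 y "z x"] y z1[of x] by simp
  have lo: "real (lo x) < z x" "z x \<le> real (lo x) + 1" for x
    using z1[of x] unfolding lo_def by linarith+
  have hi: "real (hi x) \<le> y * z x" "y * z x < real (hi x) + 1" for x
    using z1[of x] yz[of x] unfolding hi_def by linarith+
  have lohi: "lo x \<le> hi x" for x using lo[of x] hi[of x] yz[of x] by linarith
  have win: "{k. z x \<le> real k \<and> real k \<le> y * z x} = {lo x<..hi x}" for x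
  proof (intro set_eqI, simp, intro conj_cong)
    fix k
    show "z x \<le> real k \<longleftrightarrow> lo x < k" using lo[of x] by linarith
    show "real k \<le> y * z x \<longleftrightarrow> k \<le> hi x" using hi[of x] by linarith
  qed
  have yz_top: "filterlim (\<lambda>x. y * z x) at_top F"
    by (rule filterlim_at_top_mono[OF z]) (simp add: yz)
  have "((\<lambda>x. (dead_harm D (hi x) - ln (y * z x) / 2) - (dead_harm D (lo x) - ln (z x) / 2) + ln y / 2)
      \<longlongrightarrow> \<kappa> - \<kappa> + ln y / 2) F"
  proof (intro tendsto_add tendsto_diff tendsto_const)
    show "((\<lambda>x. dead_harm D (hi x) - ln (y * z x) / 2) \<longlongrightarrow> \<kappa>) F"
      by (rule dead_harm_round[OF \<kappa> yz_top]) (use hi in \<open>smt (verit)\<close>)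
    show "((\<lambda>x. dead_harm D (lo x) - ln (z x) / 2) \<longlongrightarrow> \<kappa>) F"
      by (rule dead_harm_round[OF \<kappa> z]) (use lo in \<open>smt (verit)\<close>)
  qed
  moreover have "(dead_harm D (hi x) - ln (y * z x) / 2) - (dead_harm D (lo x) - ln (z x) / 2) + ln y / 2
      = (\<Sum>k\<in>{k. z x \<le> real k \<and> real k \<le> y * z x} \<inter> D. 1 / k)" for x
    unfolding win dead_harm_diff[OF lohi] using y z1[of x] by (simp add: ln_mult field_simps)
  ultimately show ?thesis by simp
qed

lemma dead_harm_over_ln:
  assumes "log_balanced D"
  shows "(\<lambda>m. dead_harm D m / ln m) \<longlonglongrightarrow> 1 / 2"
proof -
  obtain \<kappa> where \<kappa>: "(\<lambda>m. dead_harm D m - ln m / 2) \<longlonglongrightarrow> \<kappa>"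
    using dead_harm_asymp[OF assms] by blast
  have "(\<lambda>m::nat. inverse (ln (real m))) \<longlonglongrightarrow> 0" by real_asymp
  from tendsto_add[OF tendsto_mult[OF \<kappa> this] tendsto_const[of "1 / 2"]]
  have "(\<lambda>m. (dead_harm D m - ln m / 2) * inverse (ln m) + 1 / 2) \<longlonglongrightarrow> 1 / 2" by simp
  then show ?thesis
    by (rule Lim_transform_eventually)
       (use eventually_gt_at_top[of 1] in \<open>eventually_elim, simp add: field_simps\<close>)
qed

text \<open>
  The exponent \<open>j\<close> in \<open>k = S_B(k) * B^j\<close>; it is a natural number since lengths are at least \<open>1\<close>.
\<close>

definition magnitude :: "real \<Rightarrow> nat \<Rightarrow> nat" where
  "magnitude B k = nat \<lfloor>log B k\<rfloor>"

lemma magnitude_bounds: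
  assumes B: "B > 1" and k: "k \<ge> 1"
  shows "B ^ magnitude B k \<le> k" "k < B ^ Suc (magnitude B k)"
proof -
  have 0: "log B k \<ge> 0" using B k by simp
  then have "real (magnitude B k) \<le> log B k" "log B k < real (Suc (magnitude B k))"
    unfolding magnitude_def by linarith+
  then show "B ^ magnitude B k \<le> k" "k < B ^ Suc (magnitude B k)"
    using B k by (auto simp: le_log_iff log_less_iff powr_realpow[symmetric] simp del: power_Suc)
qed

lemma magnitude_unique:
  assumes B: "B > 1" and "B ^ j \<le> real k" "real k < B ^ Suc j"
  shows "magnitude B k = j"
proof -
  have "k \<ge> 1" using assms by (metis gr0I less_one not_le of_nat_0 zero_less_power less_trans zero_less_one)
  have "j < Suc (magnitude B k)" "magnitude B k < Suc j"
    using magnitude_bounds[OF B \<open>k \<ge> 1\<close>] assms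
    by (meson power_strict_increasing_iff order_le_less_trans B)+
  then show ?thesis by simp
qed

lemma significand_eq:
  assumes B: "B > 1" and k: "k \<ge> 1"
  shows "significand B (real k) = k / B ^ magnitude B k"
proof -
  have "k / B ^ magnitude B k \<in> {1..<B} \<and> (\<exists>j::int. real k = k / B ^ magnitude B k * B powi j)"
    using magnitude_bounds[OF B k] B
    by (intro conjI exI[of _ "int (magnitude B k)"]) (auto simp: field_simps)
  then show ?thesis
    unfolding significand_def using significand_ex1[OF B, of k] k by (intro the1_equality) auto
qed

lemma significand_le_iff_window:
  assumes B: "B > 1" and s: "s < B"
  shows "k \<ge> 1 \<and> significand B (real k) \<le> s \<and> magnitude B k = j \<longleftrightarrow> B ^ j \<le> real k \<and> real k \<le> s * B ^ j"
proof
  assume *: "k \<ge> 1 \<and> significand B (real k) \<le> s \<and> magnitude B k = j"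
  then show "B ^ j \<le> real k \<and> real k \<le> s * B ^ j"
    using magnitude_bounds[OF B, of k] significand_eq[OF B, of k] B
    by (auto simp: divide_le_eq)
next
  assume *: "B ^ j \<le> real k \<and> real k \<le> s * B ^ j"
  then have k: "k \<ge> 1" using B by (metis gr0I less_one not_le of_nat_0 zero_less_power less_trans zero_less_one)
  have "s * B ^ j < B ^ Suc j" using s B by simp
  with * have "magnitude B k = j" by (intro magnitude_unique[OF B]) auto
  with * k B show "k \<ge> 1 \<and> significand B (real k) \<le> s \<and> magnitude B k = j"
    using significand_eq[OF B k] by (auto simp: divide_le_eq)
qed

lemma magnitude_over_ln:
  assumes B: "B > 1"
  shows "(\<lambda>m. real (magnitude B m) / ln m) \<longlonglongrightarrow> 1 / ln B"
proof -
  have "(\<lambda>m. magnitude B m / ln m - 1 / ln B) \<longlonglongrightarrow> 0"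
  proof (rule Lim_null_comparison)
    show "(\<lambda>m::nat. inverse (ln (real m))) \<longlonglongrightarrow> 0" by real_asymp
    show "eventually (\<lambda>m. norm (magnitude B m / ln m - 1 / ln B) \<le> inverse (ln m)) sequentially"
      using eventually_gt_at_top[of 1]
    proof eventually_elim
      case (elim m)
      then have "log B m \<ge> 0" "ln m > 0" using B by auto
      then have "\<bar>real (magnitude B m) - log B m\<bar> \<le> 1" unfolding magnitude_def by linarith
      then have "\<bar>real (magnitude B m) - log B m\<bar> / ln m \<le> 1 / ln m"
        using \<open>ln m > 0\<close> by (intro divide_right_mono) auto
      moreover have "magnitude B m / ln m - 1 / ln B = (magnitude B m - log B m) / ln m"
        using \<open>ln m > 0\<close> by (simp add: log_def field_simps)
      ultimately show ?case using \<open>ln m > 0\<close> by (simp add: abs_divide inverse_eq_divide)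
    qed
  qed
  then show ?thesis by (rule LIM_zero_cancel)
qed

text \<open>
  The relevant \<open>k\<close> of magnitude \<open>j\<close> form the window \<open>[B^j, s B^j]\<close>, whose dead elements have
  harmonic mass tending to \<open>(ln s)/2\<close>. There are about \<open>ln m / ln B\<close> windows below \<open>m\<close>, and the
  Cesaro mean of their masses has the same limit. The last window, cut off by \<open>m\<close>, has bounded
  mass and disappears on division by \<open>ln m\<close>.
\<close>

lemma log_density_significand:
  assumes D: "log_balanced D" and B: "B > 1" and s: "1 \<le> s" "s < B"
  shows "(\<lambda>m. (\<Sum>k\<in>{1..m} \<inter> D \<inter> {k. significand B (real k) \<le> s}. 1 / k) / ln m)
    \<longlonglongrightarrow> log B s / 2"
proof -
  let ?E = "{k. significand B (real k) \<le> s}"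
  define Q where "Q m = (\<Sum>k\<in>{1..m} \<inter> D \<inter> ?E. 1 / real k)" for m
  define W where "W j = {k. B ^ j \<le> real k \<and> real k \<le> s * B ^ j}" for j
  define C where "C j = (\<Sum>k\<in>W j \<inter> D. 1 / real k)" for j
  define J where "J m = magnitude B m" for m
  have finW: "finite (W j)" for j
    by (rule finite_subset[of _ "{..nat \<lfloor>s * B ^ j\<rfloor>}"]) (auto simp: W_def le_nat_floor)
  have WJ: "k \<in> W j \<longleftrightarrow> k \<ge> 1 \<and> k \<in> ?E \<and> magnitude B k = j" for k j
    using significand_le_iff_window[OF B s(2), of k j] by (auto simp: W_def)
  have "filterlim (\<lambda>j. B ^ j) at_top sequentially" using B by real_asymp
  then have C: "C \<longlonglongrightarrow> ln s / 2"
    unfolding C_def W_def using B s by (intro dead_harm_window[OF D]) auto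
  have C0: "C j \<ge> 0" for j unfolding C_def by (intro sum_nonneg) auto
  have Jln: "(\<lambda>m. J m / ln m) \<longlonglongrightarrow> 1 / ln B" unfolding J_def by (rule magnitude_over_ln[OF B])
  have Jtop: "filterlim J at_top sequentially"
    unfolding J_def magnitude_def using B
    by (intro filterlim_compose[OF filterlim_nat_sequentially] filterlim_compose[OF filterlim_floor_sequentially]) real_asymp
  have part: "(\<Sum>j\<in>T. C j) = (\<Sum>k\<in>(\<Union>j\<in>T. W j) \<inter> D. 1 / real k)" if "finite T" for T
  proof -
    have "(\<Sum>k\<in>(\<Union>j\<in>T. W j \<inter> D). 1 / real k) = (\<Sum>j\<in>T. C j)"
      unfolding C_def using that finW by (intro sum.UNION_disjoint) (auto simp: WJ)
    then show ?thesis by (simp add: Int_UN_distrib2)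
  qed
  have lower: "(\<Sum>j<J m. C j) \<le> Q m" if "m \<ge> 1" for m
  proof -
    have "k \<le> m" if "k \<in> W j" "j < J m" for k j
    proof -
      from that have k: "k \<ge> 1" "magnitude B k = j" by (auto simp: WJ)
      have "real k < B ^ Suc j" using magnitude_bounds(2)[OF B k(1)] k by simp
      also have "\<dots> \<le> B ^ J m" using that B by (intro power_increasing) auto
      also have "\<dots> \<le> m" unfolding J_def by (rule magnitude_bounds[OF B \<open>m \<ge> 1\<close>])
      finally show ?thesis by simp
    qed
    then show ?thesis
      unfolding Q_def by (subst part, simp, intro sum_mono2) (auto simp: WJ)
  qed
  have upper: "Q m \<le> (\<Sum>j<J m. C j) + C (J m)" for m
  proof -
    have "magnitude B k \<le> J m" if "1 \<le> k" "k \<le> m" for k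
      unfolding J_def magnitude_def using that B by (intro nat_mono floor_mono) auto
    then have "Q m \<le> (\<Sum>j<Suc (J m). C j)"
      unfolding Q_def using finW by (subst part, simp, intro sum_mono2) (auto simp: WJ less_Suc_eq_le)
    then show ?thesis by simp
  qed
  have "(\<lambda>m. ((\<Sum>j<J m. C j) / J m) * (J m / ln m)) \<longlonglongrightarrow> ln s / 2 * (1 / ln B)"
    by (intro tendsto_mult Jln filterlim_compose[OF cesaro_mean[OF C] Jtop])
  moreover have "((\<Sum>j<J m. C j) / J m) * (J m / ln m) = (\<Sum>j<J m. C j) / ln m" for m
    by (cases "J m = 0") auto
  ultimately have lim: "(\<lambda>m. (\<Sum>j<J m. C j) / ln m) \<longlonglongrightarrow> log B s / 2"
    by (simp only: log_def times_divide_times_eq mult_1_right mult.commute[of 2]) simp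
  have "(\<lambda>m::nat. inverse (ln (real m))) \<longlonglongrightarrow> 0" by real_asymp
  from tendsto_add[OF lim tendsto_mult[OF filterlim_compose[OF C Jtop] this]]
  have lim': "(\<lambda>m. (\<Sum>j<J m. C j) / ln m + C (J m) * inverse (ln m)) \<longlonglongrightarrow> log B s / 2" by simp
  have "(\<lambda>m. Q m / ln m) \<longlonglongrightarrow> log B s / 2"
  proof (rule tendsto_sandwich[OF _ _ lim lim'])
    show "eventually (\<lambda>m. (\<Sum>j<J m. C j) / ln m \<le> Q m / ln m) sequentially"
      using eventually_gt_at_top[of 1]
      by eventually_elim (intro divide_right_mono lower, auto)
    show "eventually (\<lambda>m. Q m / ln m \<le> (\<Sum>j<J m. C j) / ln m + C (J m) * inverse (ln m)) sequentially"
      using eventually_gt_at_top[of 1]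
    proof eventually_elim
      case (elim m)
      then have "Q m / ln m \<le> ((\<Sum>j<J m. C j) + C (J m)) / ln m"
        by (intro divide_right_mono upper) auto
      then show ?case by (simp add: distrib_right divide_inverse)
    qed
  qed
  then show ?thesis by (simp add: Q_def)
qed

section \<open>The recursion for one stick\<close>

text \<open>
  Variation of constants for the partial sums, with an arbitrary source term \<open>b\<close>. For mean
  values the source lives on \<open>D\<close>; for second moments there is also a source on living lengths.
\<close>

lemma frag_recursion_solution:
  assumes 1: "1 \<in> D"
    and rec: "\<And>l. l \<ge> 1 \<Longrightarrow> F l = b l + (if l \<in> D then 0 else 2 / (real l - 1) * (\<Sum>x\<in>{1..<l}. F x))"
  shows "(\<Sum>x=1..m. F x) = growth D m * (\<Sum>k=1..m. b k / growth D k)"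
proof (induction m)
  case (Suc m)
  let ?T = "\<Sum>x=1..m. F x" and ?V = "\<Sum>k=1..m. b k / growth D k"
  have g: "growth D (Suc m) > 0" by (rule growth_pos[OF 1])
  have F: "F (Suc m) = b (Suc m) + (if Suc m \<in> D then 0 else 2 / real m * ?T)"
    using rec[of "Suc m"] by (simp add: atLeastLessThanSuc_atLeastAtMost)
  have "?T + (if Suc m \<in> D then 0 else 2 / real m * ?T) = growth D (Suc m) * ?V"
  proof (cases "Suc m \<in> D")
    case False
    with 1 have "m \<noteq> 0" by (metis One_nat_def)
    with False show ?thesis unfolding Suc.IH by (simp add: growth_Suc field_simps)
  next
    case True
    then show ?thesis using Suc.IH by (simp only: growth_Suc if_True add_0_right mult_1_right)
  qed
  then have "?T + F (Suc m) = growth D (Suc m) * ?V + growth D (Suc m) * (b (Suc m) / growth D (Suc m))"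
    unfolding F using g by simp
  then show ?case by (simp add: distrib_left)
qed simp

corollary frag_recursion_value:
  assumes 1: "1 \<in> D"
    and rec: "\<And>l. l \<ge> 1 \<Longrightarrow> F l = b l + (if l \<in> D then 0 else 2 / (real l - 1) * (\<Sum>x\<in>{1..<l}. F x))"
    and l: "l \<ge> 1" "l \<notin> D"
  shows "F l = b l + 2 / (real l - 1) * (growth D (l - 1) * (\<Sum>k=1..l - 1. b k / growth D k))"
proof -
  have "{1..<l} = {1..l - 1}" using l by auto
  then show ?thesis
    using rec[OF l(1)] l(2) frag_recursion_solution[OF 1 rec, of "l - 1"] by simp
qed

text \<open>
  As \<open>growth D k\<close> is asymptotic to \<open>c k\<close>, the sum is \<open>1/c\<close> times the harmonic mass of
  \<open>D \<inter> A\<close>, up to \<open>o(ln l)\<close>; the factor \<open>growth D (l - 1) / (l - 1)\<close> in front supplies \<open>c\<close>, so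
  the limit does not depend on \<open>c\<close>.
\<close>

lemma frag_mean_asymp:
  assumes D: "log_balanced D"
    and dens: "(\<lambda>m. (\<Sum>k\<in>{1..m} \<inter> D \<inter> A. 1 / k) / ln m) \<longlonglongrightarrow> d"
  shows "(\<lambda>l. 2 / (real l - 1) * (growth D (l - 1) * (\<Sum>k=1..l - 1. indicator (D \<inter> A) k / growth D k)) / ln l)
    \<longlonglongrightarrow> 2 * d"
proof -
  have 1: "1 \<in> D" using D by (simp add: log_balanced_def)
  obtain c where c: "c > 0" "(\<lambda>m. growth D m / m) \<longlonglongrightarrow> c" using growth_asymp[OF D] .
  define V where "V m = (\<Sum>k=1..m. indicator (D \<inter> A) k / growth D k)" for m
  define g where "g k = real k / growth D k - 1 / c" for k
  define H where "H m = (\<Sum>k\<in>{1..m} \<inter> D \<inter> A. 1 / real k)" for m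
  have "(\<lambda>m. inverse (growth D m / m)) \<longlonglongrightarrow> inverse c" using c by (intro tendsto_inverse) auto
  then have g: "g \<longlonglongrightarrow> 0" unfolding g_def by (intro LIM_zero) (simp add: inverse_eq_divide)
  have Veq: "V m = H m / c + (\<Sum>k\<in>{1..m} \<inter> D \<inter> A. 1 / k * g k)" for m
  proof -
    have "V m = (\<Sum>k=1..m. if k \<in> D \<inter> A then 1 / growth D k else 0)"
      unfolding V_def by (intro sum.cong) (auto simp: indicator_def)
    also have "\<dots> = (\<Sum>k\<in>{1..m} \<inter> (D \<inter> A). 1 / growth D k)" by (simp add: sum.inter_restrict)
    also have "\<dots> = (\<Sum>k\<in>{1..m} \<inter> D \<inter> A. 1 / k / c + 1 / k * g k)"
      by (intro sum.cong) (auto simp: g_def algebra_simps)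
    also have "\<dots> = H m / c + (\<Sum>k\<in>{1..m} \<inter> D \<inter> A. 1 / k * g k)"
      by (simp add: sum.distrib H_def sum_divide_distrib)
    finally show ?thesis .
  qed
  have "(\<lambda>m. (\<Sum>k\<in>{1..m} \<inter> D \<inter> A. 1 / k * g k) / ln m) \<longlonglongrightarrow> 0"
  proof (rule weighted_mean_tendsto_0[OF g, where C = "\<bar>d\<bar> + 1"])
    have "eventually (\<lambda>m. H m / ln m < \<bar>d\<bar> + 1) sequentially"
      using dens[folded H_def] by (rule order_tendstoD) simp
    then show "eventually (\<lambda>m. (\<Sum>k\<in>{1..m} \<inter> D \<inter> A. 1 / k) \<le> (\<bar>d\<bar> + 1) * ln m) sequentially"
      using eventually_gt_at_top[of 1]
      by eventually_elim (simp add: H_def divide_less_eq less_imp_le)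
    show "filterlim (\<lambda>m::nat. ln (real m)) at_top sequentially" by real_asymp
  qed auto
  from tendsto_add[OF tendsto_divide[OF dens tendsto_const[of c]] this]
  have V: "(\<lambda>m. V m / ln m) \<longlonglongrightarrow> d / c"
    using c(1) by (simp add: Veq add_divide_distrib H_def divide_divide_eq_left mult.commute)
  have "(\<lambda>m. ln (real m) / ln (real (Suc m))) \<longlonglongrightarrow> 1" by real_asymp
  from tendsto_mult[OF tendsto_mult[OF tendsto_const[of 2] c(2)] tendsto_mult[OF V this]]
  have "(\<lambda>m. 2 * (growth D m / m) * (V m / ln m * (ln m / ln (Suc m)))) \<longlonglongrightarrow> 2 * d"
    using c(1) by simp
  then have "(\<lambda>m. 2 / (real (Suc m) - 1) * (growth D (Suc m - 1) * V (Suc m - 1)) / ln (Suc m)) \<longlonglongrightarrow> 2 * d"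
    by (rule Lim_transform_eventually)
       (use eventually_gt_at_top[of 1] in \<open>eventually_elim, simp\<close>)
  then show ?thesis
    unfolding V_def by (subst (asm) filterlim_sequentially_Suc) simp
qed

lemma frag_value_log_bound:
  assumes D: "log_balanced D"
    and rec: "\<And>l. l \<ge> 1 \<Longrightarrow> F l = indicator D l + (if l \<in> D then 0 else 2 / (real l - 1) * (\<Sum>x\<in>{1..<l}. F x))"
  obtains C where "C \<ge> 1" "\<And>l. l \<ge> 1 \<Longrightarrow> F l \<le> C * (1 + ln l)"
proof -
  have 1: "1 \<in> D" using D by (simp add: log_balanced_def)
  define v where "v l = 2 / (real l - 1) * (growth D (l - 1) * (\<Sum>k=1..l - 1. indicator (D \<inter> UNIV) k / growth D k))" for l
  have "(\<lambda>l. v l / ln l) \<longlonglongrightarrow> 2 * (1 / 2)"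
    unfolding v_def using dead_harm_over_ln[OF D]
    by (intro frag_mean_asymp[OF D]) (simp add: dead_harm_def)
  then have "Bseq (\<lambda>l. v l / ln l)" by (intro convergent_imp_Bseq convergentI)
  then obtain K where K: "K > 0" "\<And>l. \<bar>v l / ln l\<bar> \<le> K" by (auto simp: Bseq_def)
  show ?thesis
  proof (rule that[of "K + 1"])
    fix l :: nat assume l: "l \<ge> 1"
    then have ln: "ln l \<ge> 0" by simp
    show "F l \<le> (K + 1) * (1 + ln l)"
    proof (cases "l \<in> D")
      case True
      with rec[OF l] K(1) ln show ?thesis by (simp add: algebra_simps add_nonneg_nonneg)
    next
      case False
      with 1 l have "l \<ge> 2" by (metis One_nat_def Suc_1 le_antisym not_less_eq_eq)
      then have lnp: "ln l > 0" by simp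
      have "F l = v l" using frag_recursion_value[OF 1 rec l False] False by (simp add: v_def)
      also have "\<dots> \<le> K * ln l" using K(2)[of l] lnp by (simp add: abs_le_iff divide_le_eq)
      also have "\<dots> \<le> (K + 1) * (1 + ln l)" using K(1) ln by (simp add: algebra_simps)
      finally show ?thesis .
    qed
  qed (use K in simp)
qed

lemma harm_le_ln:
  assumes "m \<ge> 1"
  shows "harm m \<le> 1 + ln (real m)"
  using euler_mascheroni_sequence_decreasing[of 1 m] assms by (simp add: harm_def)

text \<open>
  Dividing by \<open>growth\<close> costs a factor of order \<open>1/k\<close>, and \<open>\<Sum> (1 + ln k)^2 / k\<close> up to \<open>m\<close> is at
  most \<open>(1 + ln m)^3\<close>: the source gains exactly one logarithm.
\<close>

lemma frag_value_cubic_bound: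
  assumes D: "log_balanced D"
    and rec: "\<And>l. l \<ge> 1 \<Longrightarrow> F l = b l + (if l \<in> D then 0 else 2 / (real l - 1) * (\<Sum>x\<in>{1..<l}. F x))"
    and b: "\<And>l. l \<ge> 1 \<Longrightarrow> b l \<le> K * (1 + ln l)\<^sup>2" and K: "K \<ge> 0"
  obtains C where "C \<ge> 0" "\<And>l. l \<ge> 1 \<Longrightarrow> l \<notin> D \<Longrightarrow> F l \<le> C * (1 + ln l) ^ 3"
proof -
  have 1: "1 \<in> D" using D by (simp add: log_balanced_def)
  obtain c where c: "c > 0" "(\<lambda>m. growth D m / m) \<longlonglongrightarrow> c" using growth_asymp[OF D] .
  have "Bseq (\<lambda>m. growth D m / m)" using c by (intro convergent_imp_Bseq convergentI)
  then obtain G where G: "G > 0" "\<And>m. \<bar>growth D m / m\<bar> \<le> G" by (auto simp: Bseq_def)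
  have "(\<lambda>m. inverse (growth D m / m)) \<longlonglongrightarrow> inverse c" using c by (intro tendsto_inverse) auto
  then have "Bseq (\<lambda>m. inverse (growth D m / m))" by (intro convergent_imp_Bseq convergentI)
  then obtain I where I: "I > 0" "\<And>m. \<bar>inverse (growth D m / m)\<bar> \<le> I" by (auto simp: Bseq_def)
  have gp: "growth D m > 0" for m by (rule growth_pos[OF 1])
  show ?thesis
  proof (rule that[of "K + 2 * G * K * I"])
    show "0 \<le> K + 2 * G * K * I" using K G I by simp
    fix l :: nat assume l: "l \<ge> 1" "l \<notin> D"
    define m where "m = l - 1"
    from 1 l have "l \<noteq> 1" by metis
    with l have m: "m \<ge> 1" "l = Suc m" by (auto simp: m_def)
    define u where "u = 1 + ln (real l)"
    have u: "u \<ge> 1" using l by (simp add: u_def)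
    have "(\<Sum>k=1..m. b k / growth D k) \<le> (\<Sum>k=1..m. K * u\<^sup>2 * I * inverse (real k))"
    proof (rule sum_mono)
      fix k assume k: "k \<in> {1..m}"
      then have "(1 + ln (real k))\<^sup>2 \<le> u\<^sup>2" unfolding u_def using m by (intro power_mono) auto
      then have bk: "b k \<le> K * u\<^sup>2"
        using b[of k] k K by (meson atLeastAtMost_iff mult_left_mono order_trans)
      have "real k / growth D k \<le> I" using I(2)[of k] gp[of k] by simp
      then have "1 / growth D k \<le> I * inverse (real k)" using k by (simp add: field_simps)
      then have "K * u\<^sup>2 * (1 / growth D k) \<le> K * u\<^sup>2 * (I * inverse (real k))"
        using K by (intro mult_left_mono) auto
      moreover have "b k / growth D k \<le> K * u\<^sup>2 * (1 / growth D k)"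
        using bk gp[of k] by (simp add: divide_right_mono)
      ultimately show "b k / growth D k \<le> K * u\<^sup>2 * I * inverse (real k)" by (simp add: mult.assoc)
    qed
    also have "\<dots> = K * u\<^sup>2 * I * harm m" by (simp add: harm_def sum_distrib_left)
    also have "\<dots> \<le> K * u\<^sup>2 * I * u"
    proof (intro mult_left_mono)
      have "ln (real m) \<le> ln (real l)" using m by (intro ln_mono) auto
      then show "harm m \<le> u" unfolding u_def using harm_le_ln[OF m(1)] by linarith
    qed (use K I in auto)
    finally have S: "(\<Sum>k=1..m. b k / growth D k) \<le> K * I * u ^ 3"
      by (simp add: power2_eq_square power3_eq_cube mult_ac)
    have "growth D m / m \<le> G" using G(2)[of m] by linarith
    then have "2 * (growth D m / m) * (\<Sum>k=1..m. b k / growth D k) \<le> 2 * G * (K * I * u ^ 3)"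
      using S gp[of m] K I u by (intro order_trans[OF mult_left_mono[OF S] mult_right_mono]) auto
    moreover have "b l \<le> K * u ^ 3"
    proof -
      have "b l \<le> K * u\<^sup>2" using b[OF l(1)] by (simp add: u_def)
      also have "\<dots> \<le> K * u ^ 3" using K u by (intro mult_left_mono power_increasing) auto
      finally show ?thesis .
    qed
    moreover have "F l = b l + 2 * (growth D m / m) * (\<Sum>k=1..m. b k / growth D k)"
      using frag_recursion_value[OF 1 rec l] m(2) by simp
    ultimately have "F l \<le> K * u ^ 3 + 2 * G * (K * I * u ^ 3)" by linarith
    then show "F l \<le> (K + 2 * G * K * I) * (1 + ln l) ^ 3"
      unfolding u_def[symmetric] by (simp add: algebra_simps)
  qed
qed

section \<open>Independence of the sticks\<close>

abbreviation expect :: "'a pmf \<Rightarrow> ('a \<Rightarrow> real) \<Rightarrow> real" where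
  "expect p X \<equiv> measure_pmf.expectation p X"

abbreviation append_pmf :: "'a list pmf \<Rightarrow> 'a list pmf \<Rightarrow> 'a list pmf" where
  "append_pmf p q \<equiv> map_pmf (\<lambda>(xs, ys). xs @ ys) (pair_pmf p q)"

definition weight :: "('a \<Rightarrow> real) \<Rightarrow> 'a list \<Rightarrow> real" where
  "weight w xs = sum_list (map w xs)"

lemma weight_append [simp]: "weight w (xs @ ys) = weight w xs + weight w ys"
  by (simp add: weight_def)

lemma weight_Nil [simp]: "weight w [] = 0"
  by (simp add: weight_def)

lemma expect_pair_mult:
  assumes "finite (set_pmf p)" "finite (set_pmf q)"
  shows "expect (pair_pmf p q) (\<lambda>z. f (fst z) * g (snd z)) = expect p f * expect q g"
proof -
  let ?A = "set_pmf p" and ?B = "set_pmf q"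
  have "expect (pair_pmf p q) (\<lambda>z. f (fst z) * g (snd z))
      = (\<Sum>z\<in>?A \<times> ?B. f (fst z) * g (snd z) * pmf (pair_pmf p q) z)"
    using assms by (intro integral_measure_pmf_real) auto
  also have "\<dots> = (\<Sum>x\<in>?A. \<Sum>y\<in>?B. (f x * pmf p x) * (g y * pmf q y))"
    by (subst sum.cartesian_product) (auto intro!: sum.cong simp: pmf_pair mult_ac)
  also have "\<dots> = (\<Sum>x\<in>?A. f x * pmf p x) * (\<Sum>y\<in>?B. g y * pmf q y)"
    by (simp add: sum_product)
  also have "\<dots> = expect p f * expect q g"
    using assms by (simp add: integral_measure_pmf_real[where A = ?A] integral_measure_pmf_real[where A = ?B])
  finally show ?thesis .
qed

text \<open>
  Sums over a concatenation of independent collections: means add, and the cross term in the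
  second moment factors.
\<close>

lemma weight_append_pmf:
  assumes "finite (set_pmf p)" "finite (set_pmf q)"
  shows "expect (append_pmf p q) (weight w) = expect p (weight w) + expect q (weight w)"
    and "expect (append_pmf p q) (\<lambda>xs. (weight w xs)\<^sup>2) = expect p (\<lambda>xs. (weight w xs)\<^sup>2)
      + expect q (\<lambda>xs. (weight w xs)\<^sup>2) + 2 * (expect p (weight w) * expect q (weight w))"
proof -
  have [simp]: "integrable (measure_pmf (pair_pmf p q)) h" for h :: "_ \<Rightarrow> real"
    using assms by (intro integrable_measure_pmf_finite) simp
  have "expect (append_pmf p q) (weight w)
      = expect (pair_pmf p q) (\<lambda>z. weight w (fst z) + weight w (snd z))"
    by (simp add: case_prod_beta)
  then show "expect (append_pmf p q) (weight w) = expect p (weight w) + expect q (weight w)"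
    by simp
  have "expect (append_pmf p q) (\<lambda>xs. (weight w xs)\<^sup>2) = expect (pair_pmf p q)
      (\<lambda>z. (weight w (fst z))\<^sup>2 + (weight w (snd z))\<^sup>2 + 2 * (weight w (fst z) * weight w (snd z)))"
    by (simp add: case_prod_beta power2_sum mult.assoc)
  then show "expect (append_pmf p q) (\<lambda>xs. (weight w xs)\<^sup>2) = expect p (\<lambda>xs. (weight w xs)\<^sup>2)
      + expect q (\<lambda>xs. (weight w xs)\<^sup>2) + 2 * (expect p (weight w) * expect q (weight w))"
    by (simp add: expect_pair_mult[OF assms] expectation_pair_pmf_fst[where f = "\<lambda>x. (weight w x)\<^sup>2"]
        expectation_pair_pmf_snd[where f = "\<lambda>x. (weight w x)\<^sup>2"])
qed

lemma append_pmf_assoc: "append_pmf (append_pmf p q) r = append_pmf p (append_pmf q r)"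
  by (simp add: pair_pmf_def map_pmf_def bind_assoc_pmf bind_return_pmf)

lemma append_pmf_Nil [simp]: "append_pmf (return_pmf []) q = q"
  by (simp add: pair_pmf_def map_pmf_def bind_assoc_pmf bind_return_pmf bind_return_pmf')

lemma break_all_append: "break_all D (xs @ ys) = append_pmf (break_all D xs) (break_all D ys)"
  by (induction xs) (simp_all add: append_pmf_assoc)

text \<open>
  A process that treats the parts of a concatenation independently can be run on the parts
  separately. This lifts independence from one level to the whole fragmentation process.
\<close>

lemma bind_append_pmf:
  assumes "\<And>xs ys. f (xs @ ys) = append_pmf (f xs) (f ys)"
  shows "bind_pmf (append_pmf p q) f = append_pmf (bind_pmf p f) (bind_pmf q f)"
proof -
  have "bind_pmf (append_pmf p q) f
      = bind_pmf p (\<lambda>xs. bind_pmf q (\<lambda>ys. bind_pmf (f xs) (\<lambda>us. bind_pmf (f ys) (\<lambda>vs. return_pmf (us @ vs)))))"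
    by (simp add: pair_pmf_def map_pmf_def bind_assoc_pmf bind_return_pmf assms)
  also have "\<dots> = bind_pmf p (\<lambda>xs. bind_pmf (f xs) (\<lambda>us. bind_pmf q (\<lambda>ys. bind_pmf (f ys) (\<lambda>vs. return_pmf (us @ vs)))))"
    by (subst bind_commute_pmf) (rule refl)
  also have "\<dots> = append_pmf (bind_pmf p f) (bind_pmf q f)"
    by (simp add: pair_pmf_def map_pmf_def bind_assoc_pmf bind_return_pmf)
  finally show ?thesis .
qed

lemma fragmentation_append:
  "fragmentation D k (xs @ ys) = append_pmf (fragmentation D k xs) (fragmentation D k ys)"
  by (induction k) (simp_all add: bind_append_pmf break_all_append pair_return_pmf1)

lemma fragmentation_Suc_first:
  "fragmentation D (Suc k) ls = bind_pmf (break_all D ls) (fragmentation D k)"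
proof (induction k arbitrary: ls)
  case (Suc k)
  have "fragmentation D (Suc (Suc k)) ls = bind_pmf (fragmentation D (Suc k) ls) (break_all D)" by simp
  also have "\<dots> = bind_pmf (bind_pmf (break_all D ls) (fragmentation D k)) (break_all D)"
    unfolding Suc ..
  also have "\<dots> = bind_pmf (break_all D ls) (fragmentation D (Suc k))" 
    by (simp only: bind_assoc_pmf fragmentation.simps(2)[abs_def])
  finally show ?case .
next
  case 0
  have "fragmentation D 0 = return_pmf" by (rule ext) simp
  then show ?case by (simp add: bind_return_pmf bind_return_pmf')
qed

lemma finite_set_break_stick [simp]:
  assumes "1 \<in> D" "0 < l"
  shows "finite (set_pmf (break_stick D l))"
proof (cases "l \<in> D")
  case False
  with assms have "l \<noteq> 1" by auto
  with assms have "{1..l - 1} \<noteq> {}" by auto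
  with False show ?thesis by (simp add: break_stick_def)
qed (simp add: break_stick_def)

lemma finite_set_break_all:
  assumes "1 \<in> D" "\<forall>l\<in>set ls. 0 < l"
  shows "finite (set_pmf (break_all D ls))"
  using assms by (induction ls) auto

lemma finite_set_fragmentation:
  assumes "1 \<in> D" "0 < L"
  shows "finite (set_pmf (fragmentation D k (replicate R L)))"
proof (induction k)
  case (Suc k)
  have "finite (set_pmf (break_all D xs))" if "xs \<in> set_pmf (fragmentation D k (replicate R L))" for xs
    using set_fragmentation[OF assms that] by (intro finite_set_break_all assms) auto
  with Suc show ?case by simp
qed simp

lemma finite_set_ending_sticks:
  "1 \<in> D \<Longrightarrow> 0 < L \<Longrightarrow> finite (set_pmf (ending_sticks D R L))"
  unfolding ending_sticks_def by (rule finite_set_fragmentation)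

lemma ending_sticks_Suc:
  "ending_sticks D (Suc R) L = append_pmf (ending_sticks D 1 L) (ending_sticks D R L)"
  using fragmentation_append[of D L "[L]" "replicate R L"] by (simp add: ending_sticks_def)

lemma ending_sticks_0: "ending_sticks D 0 L = return_pmf []"
proof -
  have "fragmentation D k [] = return_pmf []" for k by (induction k) (simp_all add: bind_return_pmf)
  then show ?thesis by (simp add: ending_sticks_def)
qed

lemma ending_sticks_dead_start:
  assumes "1 \<in> D" "0 < l" "l \<in> D"
  shows "ending_sticks D 1 l = return_pmf [l]"
proof -
  have "fragmentation D k [l] = return_pmf [l]" for k
    using assms by (induction k) (simp_all add: break_stick_def bind_return_pmf pair_return_pmf1)
  then show ?thesis by (simp add: ending_sticks_def)
qed

text \<open>
  Conditioning on the first break. Running the process for more levels than the length changes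
  nothing, so one level can be split off at the start while both pieces still run to the end.
\<close>

lemma ending_sticks_living_start:
  assumes "1 \<in> D" "0 < l" "l \<notin> D"
  shows "ending_sticks D 1 l = bind_pmf (pmf_of_set {1..<l})
    (\<lambda>x. append_pmf (ending_sticks D 1 x) (ending_sticks D 1 (l - x)))"
proof -
  have "l \<noteq> 1" using assms by auto
  with assms have l: "{1..<l} \<noteq> {}" by auto
  have set: "{1..l - 1} = {1..<l}" using assms by auto
  have "ending_sticks D 1 l = fragmentation D (Suc l) [l]"
    using fragmentation_eq_ending_sticks[OF assms(1,2), of "Suc l" 1] by simp
  also have "\<dots> = bind_pmf (break_stick D l) (fragmentation D l)"
    by (simp only: fragmentation_Suc_first)
       (simp add: pair_return_pmf2 map_pmf_comp case_prod_beta)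
  also have "\<dots> = bind_pmf (pmf_of_set {1..<l}) (\<lambda>x. fragmentation D l ([x] @ [l - x]))"
    using assms unfolding set[symmetric] by (simp add: break_stick_def bind_map_pmf)
  also have "\<dots> = bind_pmf (pmf_of_set {1..<l})
      (\<lambda>x. append_pmf (ending_sticks D 1 x) (ending_sticks D 1 (l - x)))"
  proof (intro bind_pmf_cong refl)
    fix x assume "x \<in> set_pmf (pmf_of_set {1..<l})"
    then have "x \<in> {1..<l}" using l by simp
    then show "fragmentation D l ([x] @ [l - x]) = append_pmf (ending_sticks D 1 x) (ending_sticks D 1 (l - x))"
      unfolding fragmentation_append
      using fragmentation_eq_ending_sticks[OF assms(1), of x l 1] fragmentation_eq_ending_sticks[OF assms(1), of "l - x" l 1]
      by simp
  qed
  finally show ?thesis .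
qed

section \<open>Moments of the ending collection\<close>

definition stick_mean :: "nat set \<Rightarrow> (nat \<Rightarrow> real) \<Rightarrow> nat \<Rightarrow> real" where
  "stick_mean D w l = expect (ending_sticks D 1 l) (weight w)"

definition stick_second_moment :: "nat set \<Rightarrow> (nat \<Rightarrow> real) \<Rightarrow> nat \<Rightarrow> real" where
  "stick_second_moment D w l = expect (ending_sticks D 1 l) (\<lambda>xs. (weight w xs)\<^sup>2)"

lemma sum_reflect: "(\<Sum>x\<in>{1..<l}. f (l - x)) = (\<Sum>x\<in>{1..<l::nat}. f x :: real)"
  by (rule sum.reindex_bij_witness[of _ "\<lambda>x. l - x" "\<lambda>x. l - x"]) auto

lemma expect_ending_sticks_living_start:
  assumes "1 \<in> D" "l \<ge> 1" "l \<notin> D"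
  shows "expect (ending_sticks D 1 l) h =
    (\<Sum>x\<in>{1..<l}. expect (append_pmf (ending_sticks D 1 x) (ending_sticks D 1 (l - x))) h) / (real l - 1)"
proof -
  from assms have "l \<noteq> 1" by auto
  with assms have l: "{1..<l} \<noteq> {}" "real (card {1..<l}) = real l - 1" by auto
  have "expect (ending_sticks D 1 l) h = (\<Sum>x\<in>{1..<l}.
      expect (append_pmf (ending_sticks D 1 x) (ending_sticks D 1 (l - x))) h /\<^sub>R real (card {1..<l}))"
    unfolding ending_sticks_living_start[OF assms(1) less_le_trans[OF zero_less_one assms(2)] assms(3)]
    by (rule pmf_expectation_bind_pmf_of_set)
       (use l finite_set_ending_sticks[OF assms(1)] in \<open>auto simp del: One_nat_def\<close>)
  then show ?thesis unfolding l(2) by (simp add: sum_distrib_left[symmetric] divide_inverse mult.commute)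
qed

lemma stick_mean_rec:
  assumes "1 \<in> D" "l \<ge> 1"
  shows "stick_mean D w l = (if l \<in> D then w l else 0)
    + (if l \<in> D then 0 else 2 / (real l - 1) * (\<Sum>x\<in>{1..<l}. stick_mean D w x))"
proof (cases "l \<in> D")
  case True
  then show ?thesis using assms by (simp add: stick_mean_def ending_sticks_dead_start weight_def del: One_nat_def)
next
  case False
  have "stick_mean D w l = (\<Sum>x\<in>{1..<l}. stick_mean D w x + stick_mean D w (l - x)) / (real l - 1)"
    unfolding stick_mean_def expect_ending_sticks_living_start[OF assms False]
    by (intro arg_cong2[where f = "(/)"] sum.cong refl weight_append_pmf finite_set_ending_sticks assms) auto
  also have "\<dots> = 2 / (real l - 1) * (\<Sum>x\<in>{1..<l}. stick_mean D w x)"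
    by (simp add: sum.distrib sum_reflect del: One_nat_def)
  finally show ?thesis using False by simp
qed

lemma stick_second_moment_rec:
  assumes "1 \<in> D" "l \<ge> 1"
  shows "stick_second_moment D w l =
    (if l \<in> D then (w l)\<^sup>2 else 2 / (real l - 1) * (\<Sum>x\<in>{1..<l}. stick_mean D w x * stick_mean D w (l - x)))
    + (if l \<in> D then 0 else 2 / (real l - 1) * (\<Sum>x\<in>{1..<l}. stick_second_moment D w x))"
proof (cases "l \<in> D")
  case True
  then show ?thesis using assms by (simp add: stick_second_moment_def ending_sticks_dead_start weight_def del: One_nat_def)
next
  case False
  have "stick_second_moment D w l = (\<Sum>x\<in>{1..<l}. stick_second_moment D w x + stick_second_moment D w (l - x)
      + 2 * (stick_mean D w x * stick_mean D w (l - x))) / (real l - 1)"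
    unfolding stick_second_moment_def stick_mean_def expect_ending_sticks_living_start[OF assms False]
    by (intro arg_cong2[where f = "(/)"] sum.cong refl weight_append_pmf finite_set_ending_sticks assms) auto
  also have "\<dots> = 2 / (real l - 1) * (\<Sum>x\<in>{1..<l}. stick_mean D w x * stick_mean D w (l - x))
      + 2 / (real l - 1) * (\<Sum>x\<in>{1..<l}. stick_second_moment D w x)"
    by (simp add: sum.distrib sum_reflect sum_distrib_left[symmetric] add_divide_distrib del: One_nat_def)
  finally show ?thesis using False by simp
qed

text \<open>
  The second formula says that the variance of the sum over \<open>R\<close> sticks is \<open>R\<close> times the variance
  for one stick.
\<close>

lemma ending_sticks_moments:
  assumes "1 \<in> D" "0 < L"
  shows "expect (ending_sticks D R L) (weight w) = R * stick_mean D w L"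
    and "expect (ending_sticks D R L) (\<lambda>xs. (weight w xs)\<^sup>2)
      = R * (stick_second_moment D w L - (stick_mean D w L)\<^sup>2) + (R * stick_mean D w L)\<^sup>2"
proof -
  show mean: "expect (ending_sticks D R L) (weight w) = R * stick_mean D w L" for R
  proof (induction R)
    case (Suc R)
    then show ?case
      unfolding ending_sticks_Suc[of D R] stick_mean_def
      by (simp add: weight_append_pmf finite_set_ending_sticks assms distrib_right
          del: One_nat_def integral_map_pmf)
  qed (simp add: ending_sticks_0)
  show "expect (ending_sticks D R L) (\<lambda>xs. (weight w xs)\<^sup>2)
      = R * (stick_second_moment D w L - (stick_mean D w L)\<^sup>2) + (R * stick_mean D w L)\<^sup>2"
  proof (induction R)
    case (Suc R)
    have "expect (ending_sticks D (Suc R) L) (\<lambda>xs. (weight w xs)\<^sup>2)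
        = stick_second_moment D w L + expect (ending_sticks D R L) (\<lambda>xs. (weight w xs)\<^sup>2)
          + 2 * (stick_mean D w L * (R * stick_mean D w L))"
      using mean[of R] unfolding ending_sticks_Suc[of D R] stick_second_moment_def stick_mean_def
      by (simp add: weight_append_pmf finite_set_ending_sticks assms del: One_nat_def integral_map_pmf)
    then show ?case unfolding Suc.IH by (simp add: power2_eq_square algebra_simps)
  qed (simp add: ending_sticks_0)
qed

section \<open>From moments to the proportion\<close>

lemma weight_abs_le:
  assumes "\<And>m. m \<in> set xs \<Longrightarrow> \<bar>w m\<bar> \<le> 1"
  shows "\<bar>weight w xs\<bar> \<le> weight (\<lambda>_. 1) xs"
  using assms
proof (induction xs)
  case (Cons x xs)
  have "\<bar>weight w xs\<bar> \<le> weight (\<lambda>_. 1) xs" "\<bar>w x\<bar> \<le> 1" using Cons by auto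
  then show ?case by (simp add: weight_def)
qed simp

lemma weight_one: "weight (\<lambda>_. 1) xs = length xs"
  by (simp add: weight_def sum_list_triv)

lemma weight_linear: "weight (\<lambda>m. v m - p) xs = weight v xs - p * length xs"
  by (induction xs) (simp_all add: weight_def algebra_simps)

lemma weight_indicator: "weight (\<lambda>m. if P m then 1 else 0) xs = length (filter P xs)"
  by (induction xs) (simp_all add: weight_def)

lemma stick_mean_linear:
  assumes "1 \<in> D" "0 < l"
  shows "stick_mean D (\<lambda>m. v m - p) l = stick_mean D v l - p * stick_mean D (\<lambda>_. 1) l"
proof -
  have [simp]: "integrable (measure_pmf (ending_sticks D 1 l)) h" for h :: "_ \<Rightarrow> real"
    using assms by (intro integrable_measure_pmf_finite finite_set_ending_sticks)
  show ?thesis by (simp add: stick_mean_def weight_linear[abs_def] weight_one[abs_def] del: One_nat_def)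
qed

lemma stick_second_moment_le:
  assumes "1 \<in> D" "0 < l" "\<And>m. \<bar>w m\<bar> \<le> 1"
  shows "stick_second_moment D w l \<le> stick_second_moment D (\<lambda>_. 1) l"
  unfolding stick_second_moment_def
proof (rule integral_mono)
  have int: "integrable (measure_pmf (ending_sticks D 1 l)) h" for h :: "_ \<Rightarrow> real"
    using assms by (intro integrable_measure_pmf_finite finite_set_ending_sticks)
  show "integrable (measure_pmf (ending_sticks D 1 l)) (\<lambda>xs. (weight w xs)\<^sup>2)"
    and "integrable (measure_pmf (ending_sticks D 1 l)) (\<lambda>xs. (weight (\<lambda>_. 1) xs)\<^sup>2)"
    by (rule int)+
  fix xs
  have "\<bar>weight w xs\<bar> \<le> weight (\<lambda>_. 1) xs" using assms by (intro weight_abs_le) auto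
  then show "(weight w xs)\<^sup>2 \<le> (weight (\<lambda>_. 1) xs)\<^sup>2"
    by (metis abs_ge_zero power2_abs power_mono)
qed

text \<open>
  The quotient \<open>a / N\<close> is controlled without any lower bound on \<open>N\<close>. If \<open>N \<ge> \<mu>/2\<close>, the
  denominator may be replaced by \<open>\<mu>/2\<close>; otherwise the distance is at most \<open>1\<close>, and \<open>N\<close> itself
  deviates from \<open>\<mu>\<close> by more than \<open>\<mu>/2\<close>. The default value \<open>a / 0 = 0\<close> falls under the second case.
\<close>

lemma ratio_deviation_bound:
  fixes a N p \<mu> :: real
  assumes N: "0 \<le> a" "a \<le> N" and p: "0 \<le> p" "p \<le> 1" and \<mu>: "\<mu> > 0"
  shows "(a / N - p)\<^sup>2 \<le> 4 / \<mu>\<^sup>2 * ((a - p * N)\<^sup>2 + (N - \<mu>)\<^sup>2)"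
proof (cases "N \<ge> \<mu> / 2")
  case True
  then have Np: "N > 0" using \<mu> by linarith
  have "(a / N - p)\<^sup>2 = (a - p * N)\<^sup>2 / N\<^sup>2"
    using Np by (simp add: power_divide[symmetric] diff_divide_distrib)
  also have "\<dots> \<le> (a - p * N)\<^sup>2 / (\<mu> / 2)\<^sup>2"
    using True \<mu> Np by (intro divide_left_mono power_mono mult_pos_pos) auto
  also have "\<dots> = 4 / \<mu>\<^sup>2 * (a - p * N)\<^sup>2" by (simp add: power_divide)
  also have "\<dots> \<le> 4 / \<mu>\<^sup>2 * ((a - p * N)\<^sup>2 + (N - \<mu>)\<^sup>2)" by (intro mult_left_mono) auto
  finally show ?thesis .
next
  case False
  have "a / N \<le> 1" "0 \<le> a / N" using N by (auto simp: divide_le_eq_1)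
  with p have "\<bar>a / N - p\<bar> \<le> 1" by linarith
  then have "(a / N - p)\<^sup>2 \<le> 1" by (simp add: abs_square_le_1)
  also have "1 = 4 / \<mu>\<^sup>2 * (\<mu> / 2)\<^sup>2" using \<mu> by (simp add: power_divide)
  also have "\<dots> \<le> 4 / \<mu>\<^sup>2 * (\<mu> - N)\<^sup>2" using False \<mu> by (intro mult_left_mono power_mono) auto
  also have "\<dots> \<le> 4 / \<mu>\<^sup>2 * ((a - p * N)\<^sup>2 + (N - \<mu>)\<^sup>2)"
    by (intro mult_left_mono) (auto simp: power2_commute)
  finally show ?thesis .
qed

text \<open>
  The bound \<open>ratio_deviation_bound\<close> in expectation, with \<open>\<mu>\<close> the mean number of ending sticks. The
  numerator deviation is a sum over the ending sticks of values of modulus at most \<open>1\<close>, so the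
  second moment \<open>M\<close> of the number of ending sticks of one stick bounds both variances. The last
  term comes from the mean of that numerator: it measures how far the quotient of the two means
  is from \<open>p\<close>.
\<close>

lemma proportion_deviation_bound:
  fixes D :: "nat set"
  defines "N \<equiv> stick_mean D (\<lambda>_. 1)" and "M \<equiv> stick_second_moment D (\<lambda>_. 1)"
  assumes 1: "1 \<in> D" and L: "0 < L" and p: "0 \<le> p" "p \<le> 1" and R: "R > 0" and N: "N L > 0"
  shows "expect (ending_sticks D R L) (\<lambda>xs. (length (filter P xs) / length xs - p)\<^sup>2)
    \<le> 8 * M L / (R * (N L)\<^sup>2) + 4 * (stick_mean D (\<lambda>m. if P m then 1 else 0) L / N L - p)\<^sup>2"
proof -
  let ?E = "expect (ending_sticks D R L)"
  let ?F = "stick_mean D (\<lambda>m. if P m then 1 else 0) L"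
  define w where "w m = (if P m then 1 else 0) - p" for m
  define \<mu> where "\<mu> = R * N L"
  have \<mu>: "\<mu> > 0" using R N by (simp add: \<mu>_def)
  have int [simp]: "integrable (measure_pmf (ending_sticks D R L)) h" for h :: "_ \<Rightarrow> real"
    using 1 L by (intro integrable_measure_pmf_finite finite_set_ending_sticks)
  have ww: "weight w xs = length (filter P xs) - p * length xs" for xs
    unfolding w_def weight_linear weight_indicator ..
  have mw: "stick_mean D w L = ?F - p * N L" unfolding w_def N_def by (rule stick_mean_linear[OF 1 L])
  have sw: "stick_second_moment D w L \<le> M L"
    unfolding M_def by (rule stick_second_moment_le[OF 1 L]) (use p in \<open>auto simp: w_def\<close>)
  have E1: "?E (\<lambda>xs. (weight w xs)\<^sup>2) \<le> R * M L + (R * (?F - p * N L))\<^sup>2"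
    unfolding ending_sticks_moments[OF 1 L] mw using sw
    by (intro add_right_mono mult_left_mono) (auto intro: order_trans[rotated])
  have "?E (\<lambda>xs. (real (length xs) - \<mu>)\<^sup>2)
      = ?E (\<lambda>xs. (weight (\<lambda>_. 1) xs)\<^sup>2 - 2 * \<mu> * weight (\<lambda>_. 1) xs + \<mu>\<^sup>2)"
    by (rule Bochner_Integration.integral_cong) (simp_all add: weight_one power2_diff mult_ac)
  also have "\<dots> = ?E (\<lambda>xs. (weight (\<lambda>_. 1) xs)\<^sup>2) - 2 * \<mu> * ?E (weight (\<lambda>_. 1)) + \<mu>\<^sup>2"
    by simp
  also have "\<dots> = R * (M L - (N L)\<^sup>2)"
    unfolding ending_sticks_moments[OF 1 L] N_def[symmetric] M_def[symmetric] \<mu>_def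
    by (simp add: power2_eq_square algebra_simps)
  also have "\<dots> \<le> R * M L" by (intro mult_left_mono) auto
  finally have E2: "?E (\<lambda>xs. (real (length xs) - \<mu>)\<^sup>2) \<le> R * M L" .
  have "?E (\<lambda>xs. (length (filter P xs) / length xs - p)\<^sup>2)
      \<le> ?E (\<lambda>xs. 4 / \<mu>\<^sup>2 * ((weight w xs)\<^sup>2 + (real (length xs) - \<mu>)\<^sup>2))"
    unfolding ww by (intro integral_mono ratio_deviation_bound int p \<mu>) auto
  also have "\<dots> = 4 / \<mu>\<^sup>2 * (?E (\<lambda>xs. (weight w xs)\<^sup>2) + ?E (\<lambda>xs. (real (length xs) - \<mu>)\<^sup>2))"
    by simp
  also have "\<dots> \<le> 4 / \<mu>\<^sup>2 * (R * M L + (R * (?F - p * N L))\<^sup>2 + R * M L)"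
    by (intro mult_left_mono add_mono E1 E2) auto
  also have "\<dots> = 8 * M L / (R * (N L)\<^sup>2) + 4 * ((?F - p * N L) / N L)\<^sup>2"
  proof -
    have "4 / \<mu>\<^sup>2 * (R * M L + (R * (?F - p * N L))\<^sup>2 + R * M L)
        = 8 * (R * M L) / \<mu>\<^sup>2 + 4 * (R * (?F - p * N L))\<^sup>2 / \<mu>\<^sup>2"
      by (simp add: add_divide_distrib distrib_left)
    also have "8 * (R * M L) / \<mu>\<^sup>2 = 8 * M L / (R * (N L)\<^sup>2)"
      using R unfolding \<mu>_def by (simp add: power2_eq_square)
    also have "4 * (R * (?F - p * N L))\<^sup>2 / \<mu>\<^sup>2 = 4 * ((?F - p * N L) / N L)\<^sup>2"
      using R unfolding \<mu>_def by (simp add: power_mult_distrib power_divide)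
    finally show ?thesis .
  qed
  also have "(?F - p * N L) / N L = ?F / N L - p" using N by (simp add: diff_divide_distrib)
  finally show ?thesis .
qed

text \<open>
  The mean square distance from any constant is variance plus squared bias.
\<close>

lemma mean_variance_of_deviation:
  fixes X :: "'a \<Rightarrow> real"
  assumes fin: "finite (set_pmf p)"
  shows "\<bar>expect p X - c\<bar> \<le> sqrt (expect p (\<lambda>x. (X x - c)\<^sup>2))"
    and "measure_pmf.variance p X \<le> expect p (\<lambda>x. (X x - c)\<^sup>2)"
    and "measure_pmf.variance p X \<ge> 0"
proof -
  have [simp]: "integrable (measure_pmf p) h" for h :: "_ \<Rightarrow> real"
    using fin by (rule integrable_measure_pmf_finite)
  have v: "measure_pmf.variance p X = expect p (\<lambda>x. (X x)\<^sup>2) - (expect p X)\<^sup>2"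
    by (rule measure_pmf.variance_eq) simp_all
  have "expect p (\<lambda>x. (X x - c)\<^sup>2) = expect p (\<lambda>x. (X x)\<^sup>2 - 2 * c * X x + c\<^sup>2)"
    by (rule Bochner_Integration.integral_cong) (simp_all add: power2_diff mult_ac)
  also have "\<dots> = expect p (\<lambda>x. (X x)\<^sup>2) - 2 * c * expect p X + c\<^sup>2" by simp
  finally have d: "expect p (\<lambda>x. (X x - c)\<^sup>2) = measure_pmf.variance p X + (expect p X - c)\<^sup>2"
    unfolding v by (simp add: power2_eq_square algebra_simps)
  show v0: "measure_pmf.variance p X \<ge> 0" by (intro integral_nonneg_AE) simp
  show "measure_pmf.variance p X \<le> expect p (\<lambda>x. (X x - c)\<^sup>2)" unfolding d by simp
  show "\<bar>expect p X - c\<bar> \<le> sqrt (expect p (\<lambda>x. (X x - c)\<^sup>2))"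
    unfolding d using v0 by (intro real_le_rsqrt) simp
qed

section \<open>Asymptotics of the moments of one stick\<close>

lemma stick_mean_over_ln:
  assumes D: "log_balanced D"
    and dens: "(\<lambda>m. (\<Sum>k\<in>{1..m} \<inter> D \<inter> {k. P k}. 1 / k) / ln m) \<longlonglongrightarrow> d"
  shows "((\<lambda>l. stick_mean D (\<lambda>m. if P m then 1 else 0) l / ln l) \<longlongrightarrow> 2 * d)
    (inf at_top (principal {l. l > 0 \<and> l \<notin> D}))" (is "(_ \<longlongrightarrow> _) ?G")
proof -
  have 1: "1 \<in> D" using D by (simp add: log_balanced_def)
  define v where "v l = 2 / (real l - 1) *
    (growth D (l - 1) * (\<Sum>k=1..l - 1. indicator (D \<inter> {k. P k}) k / growth D k))" for l
  have eq: "stick_mean D (\<lambda>m. if P m then 1 else 0) l = v l" if l: "l > 0" "l \<notin> D" for l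
  proof -
    let ?w = "\<lambda>m. if P m then 1 else 0 :: real"
    have ind: "(if j \<in> D then ?w j else 0) = indicator (D \<inter> {k. P k}) j" for j
      by (simp add: indicator_def)
    have "stick_mean D ?w j = indicator (D \<inter> {k. P k}) j
        + (if j \<in> D then 0 else 2 / (real j - 1) * (\<Sum>x\<in>{1..<j}. stick_mean D ?w x))" if "j \<ge> 1" for j
      unfolding ind[symmetric] by (rule stick_mean_rec[OF 1 that])
    note val = frag_recursion_value[where F = "stick_mean D ?w" and b = "indicator (D \<inter> {k. P k})", OF 1 this]
    have "stick_mean D ?w l = indicator (D \<inter> {k. P k}) l + v l"
      unfolding v_def by (rule val) (use l in auto)
    then show ?thesis using l by simp
  qed
  have "((\<lambda>l. v l / ln l) \<longlongrightarrow> 2 * d) ?G"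
    unfolding v_def by (rule tendsto_mono[OF inf_le1 frag_mean_asymp[OF D dens]])
  then show ?thesis
    by (rule Lim_transform_eventually) (auto simp: eventually_inf_principal eq intro!: always_eventually)
qed

text \<open>
  On living lengths the source of the second moment recursion is twice the average of
  \<open>N(x) N(l - x)\<close>, which is \<open>O((1 + ln l)^2)\<close> because \<open>N(x) = O(1 + ln x)\<close>.
\<close>

lemma second_moment_cubic_bound:
  assumes D: "log_balanced D"
  obtains C where "C \<ge> 0"
    "\<And>l. l \<ge> 1 \<Longrightarrow> l \<notin> D \<Longrightarrow> stick_second_moment D (\<lambda>_. 1) l \<le> C * (1 + ln l) ^ 3"
proof -
  have 1: "1 \<in> D" using D by (simp add: log_balanced_def)
  let ?N = "stick_mean D (\<lambda>_. 1)"
  define b where "b l = (if l \<in> D then (1::real)\<^sup>2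
    else 2 / (real l - 1) * (\<Sum>x\<in>{1..<l}. ?N x * ?N (l - x)))" for l
  have "?N l = indicator D l + (if l \<in> D then 0 else 2 / (real l - 1) * (\<Sum>x\<in>{1..<l}. ?N x))"
    if "l \<ge> 1" for l
    using stick_mean_rec[OF 1 that, of "\<lambda>_. 1"] by (simp add: indicator_def)
  from frag_value_log_bound[OF D this] obtain C
    where C: "C \<ge> 1" "\<And>l. l \<ge> 1 \<Longrightarrow> ?N l \<le> C * (1 + ln l)" by blast
  have N0: "?N l \<ge> 0" for l unfolding stick_mean_def weight_one[abs_def] by (intro integral_nonneg_AE) simp
  have b: "b l \<le> 2 * C\<^sup>2 * (1 + ln l)\<^sup>2" if l: "l \<ge> 1" for l
  proof (cases "l \<in> D")
    case True
    have "1 * 1 \<le> C\<^sup>2 * (1 + ln (real l))\<^sup>2"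
      using C l by (intro mult_mono) (auto simp: one_le_power)
    with True show ?thesis by (simp add: b_def)
  next
    case False
    with 1 l have l2: "l \<ge> 2" by (metis One_nat_def Suc_1 le_antisym not_less_eq_eq)
    have "?N x * ?N (l - x) \<le> (C * (1 + ln l)) * (C * (1 + ln l))" if x: "x \<in> {1..<l}" for x
    proof (intro mult_mono N0)
      have le: "?N y \<le> C * (1 + ln l)" if y: "1 \<le> y" "y \<le> l" for y
      proof -
        have "C * (1 + ln y) \<le> C * (1 + ln l)" using y C by (intro mult_left_mono add_left_mono) auto
        with C(2)[OF y(1)] show ?thesis by linarith
      qed
      show "?N x \<le> C * (1 + ln l)" "?N (l - x) \<le> C * (1 + ln l)" using x by (auto intro!: le)
      show "0 \<le> C * (1 + ln l)" using C l by simp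
    qed
    then have "(\<Sum>x\<in>{1..<l}. ?N x * ?N (l - x)) \<le> real (card {1..<l}) * ((C * (1 + ln l)) * (C * (1 + ln l)))"
      by (rule sum_bounded_above)
    then have "2 / (real l - 1) * (\<Sum>x\<in>{1..<l}. ?N x * ?N (l - x))
        \<le> 2 / (real l - 1) * (real (card {1..<l}) * ((C * (1 + ln l)) * (C * (1 + ln l))))"
      using l2 by (intro mult_left_mono) auto
    also have "\<dots> = 2 * C\<^sup>2 * (1 + ln l)\<^sup>2"
      using l2 by (simp add: of_nat_diff power2_eq_square)
    finally show ?thesis using False by (simp add: b_def)
  qed
  have rec: "stick_second_moment D (\<lambda>_. 1) l = b l + (if l \<in> D then 0
      else 2 / (real l - 1) * (\<Sum>x\<in>{1..<l}. stick_second_moment D (\<lambda>_. 1) x))" if "l \<ge> 1" for l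
    unfolding b_def by (rule stick_second_moment_rec[OF 1 that])
  show ?thesis
    by (rule frag_value_cubic_bound[OF D rec b]) (use that in auto)
qed

section \<open>Convergence to Benford behavior\<close>

text \<open>
  With \<open>N(L) ~ ln L\<close>, the variance term is at most of order
  \<open>(ln L)^3 / (R (ln L)^2)\<close>, and \<open>R > (ln L)^3\<close> makes it \<open>O(1 / (ln L)^2)\<close>. The other term tends
  to \<open>0\<close> because \<open>F(L)/N(L)\<close> tends to \<open>log B s\<close>.
\<close>

lemma benford_deviation_tendsto_0:
  assumes D: "log_balanced D" and B: "B > 1" and s: "1 \<le> s" "s < B"
    and R: "\<And>L. L > 0 \<Longrightarrow> L \<notin> D \<Longrightarrow> real (R L) > ln (real L) ^ 3"
  shows "((\<lambda>L. expect (ending_sticks D (R L) L) (\<lambda>xs. (significand_proportion B s xs - log B s)\<^sup>2)) \<longlongrightarrow> 0)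
    (inf at_top (principal {L. L > 0 \<and> L \<notin> D}))" (is "(?dev \<longlongrightarrow> 0) ?G")
proof -
  have 1: "1 \<in> D" using D by (simp add: log_balanced_def)
  let ?P = "\<lambda>m. significand B (real m) \<le> s"
  define p where "p = log B s"
  define N where "N = stick_mean D (\<lambda>_. 1)"
  define F where "F = stick_mean D (\<lambda>m. if ?P m then 1 else 0)"
  have p: "0 \<le> p" "p \<le> 1" using B s by (auto simp: p_def)
  obtain C where C: "C \<ge> 0"
    "\<And>l. l \<ge> 1 \<Longrightarrow> l \<notin> D \<Longrightarrow> stick_second_moment D (\<lambda>_. 1) l \<le> C * (1 + ln l) ^ 3"
    using second_moment_cubic_bound[OF D] by blast
  have "((\<lambda>l. stick_mean D (\<lambda>m. if True then 1 else 0) l / ln l) \<longlongrightarrow> 2 * (1 / 2)) ?G"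
    using dead_harm_over_ln[OF D] by (intro stick_mean_over_ln[OF D]) (simp add: dead_harm_def)
  then have NG: "((\<lambda>L. N L / ln L) \<longlongrightarrow> 1) ?G" by (simp add: N_def)
  have "((\<lambda>L. F L / ln L) \<longlongrightarrow> 2 * (log B s / 2)) ?G"
    unfolding F_def by (rule stick_mean_over_ln[OF D log_density_significand[OF D B s]])
  then have FG: "((\<lambda>L. F L / ln L) \<longlongrightarrow> p) ?G" by (simp add: p_def)
  define bnd where "bnd L = 8 * C * ((1 + ln (real L)) ^ 3 / ln L ^ 5) / (N L / ln L)\<^sup>2
    + 4 * ((F L / ln L) / (N L / ln L) - p)\<^sup>2" for L
  have "(\<lambda>L::nat. (1 + ln (real L)) ^ 3 / ln L ^ 5) \<longlonglongrightarrow> 0" by real_asymp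
  then have Q: "((\<lambda>L::nat. (1 + ln (real L)) ^ 3 / ln L ^ 5) \<longlongrightarrow> 0) ?G"
    by (rule tendsto_mono[OF inf_le1])
  have "(bnd \<longlongrightarrow> 8 * C * 0 / 1\<^sup>2 + 4 * (p / 1 - p)\<^sup>2) ?G"
    unfolding bnd_def
    by (intro tendsto_add tendsto_mult tendsto_divide tendsto_power tendsto_diff tendsto_const NG FG Q) simp_all
  then have bnd0: "(bnd \<longlongrightarrow> 0) ?G" by simp
  have "eventually (\<lambda>L. N L / ln L > 0) ?G" using order_tendstoD(1)[OF NG, of 0] by simp
  moreover have "eventually (\<lambda>L. L \<ge> 3 \<and> L > 0 \<and> L \<notin> D) ?G"
    unfolding eventually_inf_principal by (rule eventually_mono[OF eventually_ge_at_top[of 3]]) auto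
  ultimately have "eventually (\<lambda>L. norm (?dev L) \<le> bnd L) ?G"
  proof eventually_elim
    case (elim L)
    define u where "u = ln (real L)"
    have u: "u > 0" using elim by (simp add: u_def)
    have NL: "N L > 0" using elim u by (simp add: u_def zero_less_divide_iff)
    have RL: "real (R L) > u ^ 3" using R elim by (simp add: u_def)
    then have R0: "real (R L) > 0" using zero_less_power[OF u, of 3] by linarith
    have "stick_second_moment D (\<lambda>_. 1) L \<le> C * (1 + u) ^ 3" using C(2)[of L] elim by (simp add: u_def)
    then have "8 * stick_second_moment D (\<lambda>_. 1) L / (R L * (N L)\<^sup>2) \<le> 8 * (C * (1 + u) ^ 3) / (R L * (N L)\<^sup>2)"
      using R0 by (intro divide_right_mono) auto
    also have "\<dots> \<le> 8 * (C * (1 + u) ^ 3) / (u ^ 3 * (N L)\<^sup>2)"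
      using RL C(1) u NL R0 by (intro divide_left_mono mult_right_mono) auto
    also have "\<dots> = 8 * C * ((1 + u) ^ 3 / u ^ 5) / (N L / u)\<^sup>2"
    proof -
      have u5: "u ^ 5 = u ^ 3 * u\<^sup>2" by (simp flip: power_add)
      have "8 * (C * a) / (x * n) = 8 * C * (a / (x * y)) / (n / y)" if "y > 0" for a x y n :: real
        using that by simp
      from this[OF zero_less_power[OF u]] show ?thesis unfolding u5 power_divide .
    qed
    finally have M: "8 * stick_second_moment D (\<lambda>_. 1) L / (R L * (N L)\<^sup>2)
        \<le> 8 * C * ((1 + u) ^ 3 / u ^ 5) / (N L / u)\<^sup>2" .
    have "?dev L \<le> 8 * stick_second_moment D (\<lambda>_. 1) L / (R L * (N L)\<^sup>2) + 4 * (F L / N L - p)\<^sup>2"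
      unfolding significand_proportion_def p_def[symmetric] N_def F_def
      by (rule proportion_deviation_bound[OF 1]) (use elim R0 NL p in \<open>auto simp: N_def\<close>)
    also have "\<dots> \<le> bnd L" using M u by (simp add: bnd_def u_def)
    finally have "?dev L \<le> bnd L" .
    moreover have "?dev L \<ge> 0" by (intro integral_nonneg_AE) simp
    ultimately show ?case by simp
  qed
  from Lim_null_comparison[OF this bnd0] show ?thesis .
qed

theorem theorem1p13:
  fixes n :: nat and S :: "nat set" and R :: "nat \<Rightarrow> nat" and B :: real
  assumes "n \<ge> 2" and "even n"
    and "S \<subseteq> {0..<n}" and "card S = n div 2"
    and "D = stopping_set n S"
    and "\<forall>L. L > 0 \<and> L \<notin> D \<longrightarrow> real (R L) > (ln (real L)) ^ 3"
    and "B > 1"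
  shows "\<forall>s\<in>{1..<B}.
     ((\<lambda>L. measure_pmf.expectation (ending_sticks D (R L) L) (significand_proportion B s))
        \<longlongrightarrow> log B s) (inf at_top (principal {L. L > 0 \<and> L \<notin> D})) \<and>
     ((\<lambda>L. measure_pmf.variance (ending_sticks D (R L) L) (significand_proportion B s))
        \<longlongrightarrow> 0) (inf at_top (principal {L. L > 0 \<and> L \<notin> D}))"
proof
  fix s assume s: "s \<in> {1..<B}"
  let ?G = "inf at_top (principal {L. L > 0 \<and> L \<notin> D})"
  have D: "log_balanced D" unfolding assms(5) by (rule log_balanced_stopping_set[OF assms(1-4)])
  then have 1: "1 \<in> D" by (simp add: log_balanced_def)
  let ?dev = "\<lambda>L. expect (ending_sticks D (R L) L) (\<lambda>xs. (significand_proportion B s xs - log B s)\<^sup>2)"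
  have dev: "(?dev \<longlongrightarrow> 0) ?G"
    using benford_deviation_tendsto_0[OF D \<open>B > 1\<close>, of s R] s assms(6) by simp
  have pos: "eventually (\<lambda>L. L > 0) ?G" by (simp add: eventually_inf_principal)
  have "((\<lambda>L. expect (ending_sticks D (R L) L) (significand_proportion B s) - log B s) \<longlongrightarrow> 0) ?G"
  proof (rule Lim_null_comparison)
    show "eventually (\<lambda>L. norm (expect (ending_sticks D (R L) L) (significand_proportion B s) - log B s)
        \<le> sqrt (?dev L)) ?G"
      using pos by eventually_elim
        (simp only: real_norm_def, rule mean_variance_of_deviation(1)[OF finite_set_ending_sticks[OF 1]])
    show "((\<lambda>L. sqrt (?dev L)) \<longlongrightarrow> 0) ?G" using tendsto_real_sqrt[OF dev] by simp
  qed
  then have "((\<lambda>L. expect (ending_sticks D (R L) L) (significand_proportion B s)) \<longlongrightarrow> log B s) ?G"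
    by (rule LIM_zero_cancel)
  moreover have "((\<lambda>L. measure_pmf.variance (ending_sticks D (R L) L) (significand_proportion B s)) \<longlongrightarrow> 0) ?G"
  proof (rule tendsto_sandwich[OF _ _ tendsto_const dev])
    show "eventually (\<lambda>L. 0 \<le> measure_pmf.variance (ending_sticks D (R L) L) (significand_proportion B s)) ?G"
      using pos by eventually_elim (rule mean_variance_of_deviation(3)[OF finite_set_ending_sticks[OF 1]])
    show "eventually (\<lambda>L. measure_pmf.variance (ending_sticks D (R L) L) (significand_proportion B s) \<le> ?dev L) ?G"
      using pos by eventually_elim (rule mean_variance_of_deviation(2)[OF finite_set_ending_sticks[OF 1]])
  qed
  ultimately show "((\<lambda>L. expect (ending_sticks D (R L) L) (significand_proportion B s)) \<longlongrightarrow> log B s) ?G \<and>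
     ((\<lambda>L. measure_pmf.variance (ending_sticks D (R L) L) (significand_proportion B s)) \<longlongrightarrow> 0) ?G"
    by (rule conjI)
qed

end
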